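(* Let $J\subseteq\mathbb{R}$ be a finite or infinite open interval, let $\mu$ be a non-atomic regular Borel measure on $\mathbb{R}$ whose support contains $J$. For every continuous function $f:J\to\mathbb{C}$, the divided difference $\check f$ is a closable multiplier on $J\times J$.
   Context: $\check f(x,y)=\frac{f(x)-f(y)}{x-y}$ for $(x,y)\in J\times J$, $x\ne y$; it is defined $\mu\times\mu$-almost everywhere on $J\times J$ since $\mu$ is non-atomic. Let $H=L^2(J,\mu)$. For $k\in L^2(J\times J,\mu\times\mu)$ let $I_k:H\to H$ be $(I_k\xi)(y)=\int_Jk(x,y)\xi(x)\,d\mu(x)$. For a measurable function $\varphi$ on $J\times J$ let $D(\varphi)=\{k\in L^2(J\times J):\varphi k\in L^2(J\times J)\}$ and let $S_\varphi$ be the densely defined operator on the space $\mathcal{K}(H)$ of compact operators (operator norm) with domain $\{I_k:k\in D(\varphi)\}$ given by $S_\varphi(I_k)=I_{\varphi k}$. The function $\varphi$ is a closable multiplier if $S_\varphi$ is closable, i.e. the norm closure of its graph in $\mathcal{K}(H)\oplus\mathcal{K}(H)$ is the graph of an operator. *)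

theory Defs
  imports "HOL-Analysis.Analysis"
begin

section \<open>Measures on the real line\<close>

text \<open>As usual for regular Borel measures, finiteness on compact sets is part of the definition.\<close>

definition regular_borel_measure :: "real measure \<Rightarrow> bool" where
  "regular_borel_measure \<mu> \<longleftrightarrow>
     sets \<mu> = sets borel \<and>
     (\<forall>K. compact K \<longrightarrow> emeasure \<mu> K < \<infinity>) \<and>
     (\<forall>A\<in>sets borel. emeasure \<mu> A = (INF U\<in>{U. open U \<and> A \<subseteq> U}. emeasure \<mu> U)) \<and>
     (\<forall>A\<in>sets borel. emeasure \<mu> A = (SUP K\<in>{K. compact K \<and> K \<subseteq> A}. emeasure \<mu> K))"

definition atom :: "'a measure \<Rightarrow> 'a set \<Rightarrow> bool" where
  "atom M A \<longleftrightarrow> A \<in> sets M \<and> emeasure M A > 0 \<and>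
     (\<forall>B\<in>sets M. B \<subseteq> A \<longrightarrow> emeasure M B = 0 \<or> emeasure M B = emeasure M A)"

definition non_atomic :: "'a measure \<Rightarrow> bool" where
  "non_atomic M \<longleftrightarrow> (\<nexists>A. atom M A)"

definition measure_support :: "real measure \<Rightarrow> real set" where
  "measure_support \<mu> = {x. \<forall>U. open U \<longrightarrow> x \<in> U \<longrightarrow> emeasure \<mu> U > 0}"

section \<open>The Hilbert space of square integrable functions\<close>

definition sq_integrable :: "'a measure \<Rightarrow> ('a \<Rightarrow> complex) set" where
  "sq_integrable M = {f \<in> borel_measurable M. integrable M (\<lambda>x. (cmod (f x))\<^sup>2)}"

definition ae_rel :: "'a measure \<Rightarrow> (('a \<Rightarrow> complex) \<times> ('a \<Rightarrow> complex)) set" where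
  "ae_rel M = {(f, g). f \<in> sq_integrable M \<and> g \<in> sq_integrable M \<and> (AE x in M. f x = g x)}"

type_synonym 'a L2_vec = "('a \<Rightarrow> complex) set"

text \<open>A vector of \<open>L\<^sup>2\<close> is a genuine equivalence class of functions; operations on classes are
  computed on representatives, and the lemmas below show that the choice does not matter.\<close>

definition L2 :: "'a measure \<Rightarrow> 'a L2_vec set" where
  "L2 M = sq_integrable M // ae_rel M"

definition L2_class :: "'a measure \<Rightarrow> ('a \<Rightarrow> complex) \<Rightarrow> 'a L2_vec" where
  "L2_class M f = ae_rel M `` {f}"

definition L2_rep :: "'a L2_vec \<Rightarrow> ('a \<Rightarrow> complex)" where
  "L2_rep a = (SOME f. f \<in> a)"

definition L2_add ::
    "'a measure \<Rightarrow> 'a L2_vec \<Rightarrow> 'a L2_vec \<Rightarrow> 'a L2_vec" where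
  "L2_add M a b = L2_class M (\<lambda>x. L2_rep a x + L2_rep b x)"

definition L2_scale ::
    "'a measure \<Rightarrow> complex \<Rightarrow> 'a L2_vec \<Rightarrow> 'a L2_vec" where
  "L2_scale M c a = L2_class M (\<lambda>x. c * L2_rep a x)"

definition L2_norm :: "'a measure \<Rightarrow> 'a L2_vec \<Rightarrow> real" where
  "L2_norm M a = sqrt (\<integral>x. (cmod (L2_rep a x))\<^sup>2 \<partial>M)"

lemma equiv_ae_rel: "equiv (sq_integrable M) (ae_rel M)"
  by (rule equivI) (auto simp: ae_rel_def refl_on_def sym_def trans_def)

lemma L2_class_in_L2: "f \<in> sq_integrable M \<Longrightarrow> L2_class M f \<in> L2 M"
  by (simp add: L2_def L2_class_def quotientI)

lemma L2_rep_class: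
  assumes "f \<in> sq_integrable M"
  shows "L2_rep (L2_class M f) \<in> sq_integrable M" "AE x in M. L2_rep (L2_class M f) x = f x"
proof -
  have "f \<in> L2_class M f"
    using assms by (simp add: L2_class_def ae_rel_def)
  then have "L2_rep (L2_class M f) \<in> L2_class M f"
    unfolding L2_rep_def by (rule someI[where P = "\<lambda>g. g \<in> L2_class M f"])
  then show "L2_rep (L2_class M f) \<in> sq_integrable M" "AE x in M. L2_rep (L2_class M f) x = f x"
    by (auto simp: L2_class_def ae_rel_def elim: eventually_mono)
qed

lemma L2_class_cong:
  assumes "f \<in> borel_measurable M" "g \<in> borel_measurable M" "AE x in M. f x = g x"
  shows "L2_class M f = L2_class M g"
proof -
  have "integrable M (\<lambda>x. (cmod (f x))\<^sup>2) = integrable M (\<lambda>x. (cmod (g x))\<^sup>2)"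
    using assms by (intro integrable_cong_AE) auto
  moreover have "(AE x in M. f x = h x) = (AE x in M. g x = h x)" for h
    using assms(3) by (auto elim: eventually_elim2)
  ultimately show ?thesis
    using assms by (auto simp: L2_class_def ae_rel_def sq_integrable_def)
qed

lemma sq_integrable_measurable: "f \<in> sq_integrable M \<Longrightarrow> f \<in> borel_measurable M"
  by (simp add: sq_integrable_def)

lemma L2_add_class:
  assumes "f \<in> sq_integrable M" "g \<in> sq_integrable M"
  shows "L2_add M (L2_class M f) (L2_class M g) = L2_class M (\<lambda>x. f x + g x)"
  unfolding L2_add_def
  using L2_rep_class[OF assms(1)] L2_rep_class[OF assms(2)] assms
  by (intro L2_class_cong borel_measurable_add) (auto simp: sq_integrable_measurable)

lemma L2_scale_class:
  assumes "f \<in> sq_integrable M"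
  shows "L2_scale M c (L2_class M f) = L2_class M (\<lambda>x. c * f x)"
  unfolding L2_scale_def
  using L2_rep_class[OF assms] assms
  by (intro L2_class_cong borel_measurable_times) (auto simp: sq_integrable_measurable)

lemma L2_norm_class:
  assumes "f \<in> sq_integrable M"
  shows "L2_norm M (L2_class M f) = sqrt (\<integral>x. (cmod (f x))\<^sup>2 \<partial>M)"
proof -
  note [measurable] = sq_integrable_measurable[OF assms]
    sq_integrable_measurable[OF L2_rep_class(1)[OF assms]]
  show ?thesis
    unfolding L2_norm_def
    using L2_rep_class(2)[OF assms]
    by (intro arg_cong[where f = sqrt] integral_cong_AE) auto
qed

section \<open>Compact operators\<close>

text \<open>Operators on \<open>L2 M\<close> are extensional functions (\<open>undefined\<close> off the carrier), so that
  equality of operators is HOL equality.\<close>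

type_synonym 'a L2_op = "'a L2_vec \<Rightarrow> 'a L2_vec"

definition op_add ::
    "'a measure \<Rightarrow> 'a L2_op \<Rightarrow> 'a L2_op \<Rightarrow> 'a L2_op" where
  "op_add M S T = (\<lambda>a\<in>L2 M. L2_add M (S a) (T a))"

definition op_scale ::
    "'a measure \<Rightarrow> complex \<Rightarrow> 'a L2_op \<Rightarrow> 'a L2_op" where
  "op_scale M c T = (\<lambda>a\<in>L2 M. L2_scale M c (T a))"

text \<open>The operator norm takes values in \<open>ennreal\<close>, so that it is meaningful (namely \<open>\<infinity>\<close>) for
  unbounded operators too; on bounded operators it is the usual norm.\<close>

definition op_norm ::
    "'a measure \<Rightarrow> 'a L2_op \<Rightarrow> ennreal" where
  "op_norm M T = (SUP a\<in>{a \<in> L2 M. L2_norm M a \<le> 1}. ennreal (L2_norm M (T a)))"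

definition op_dist ::
    "'a measure \<Rightarrow> 'a L2_op \<Rightarrow> 'a L2_op \<Rightarrow> ennreal" where
  "op_dist M S T = op_norm M (op_add M S (op_scale M (-1) T))"

definition L2_linear :: "'a measure \<Rightarrow> 'a L2_op \<Rightarrow> bool" where
  "L2_linear M T \<longleftrightarrow> T \<in> L2 M \<rightarrow>\<^sub>E L2 M \<and>
     (\<forall>a\<in>L2 M. \<forall>b\<in>L2 M. T (L2_add M a b) = L2_add M (T a) (T b)) \<and>
     (\<forall>c. \<forall>a\<in>L2 M. T (L2_scale M c a) = L2_scale M c (T a))"

definition compact_operators ::
    "'a measure \<Rightarrow> 'a L2_op set" where
  "compact_operators M = {T. L2_linear M T \<and>
     (\<forall>a :: nat \<Rightarrow> _. range a \<subseteq> L2 M \<longrightarrow> (\<exists>C. \<forall>n. L2_norm M (a n) \<le> C) \<longrightarrow>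
        (\<exists>r b. strict_mono (r :: nat \<Rightarrow> nat) \<and> b \<in> L2 M \<and>
           (\<lambda>n. L2_norm M (L2_add M (T (a (r n))) (L2_scale M (-1) b))) \<longlonglongrightarrow> 0))}"

section \<open>Integral operators and closable multipliers\<close>

definition integral_op ::
    "'a measure \<Rightarrow> ('a \<times> 'a \<Rightarrow> complex) \<Rightarrow> 'a L2_op" where
  "integral_op M k = (\<lambda>a\<in>L2 M. L2_class M (\<lambda>y. \<integral>x. k (x, y) * L2_rep a x \<partial>M))"

definition mult_domain ::
    "'a measure \<Rightarrow> ('a \<times> 'a \<Rightarrow> complex) \<Rightarrow> ('a \<times> 'a \<Rightarrow> complex) set" where
  "mult_domain M \<phi> =
     {k \<in> sq_integrable (M \<Otimes>\<^sub>M M). (\<lambda>z. \<phi> z * k z) \<in> sq_integrable (M \<Otimes>\<^sub>M M)}"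

text \<open>The partially defined operator \<open>I\<^sub>k \<mapsto> I\<^bsub>\<phi>k\<^esub>\<close>, given by its graph.\<close>

definition mult_graph ::
    "'a measure \<Rightarrow> ('a \<times> 'a \<Rightarrow> complex) \<Rightarrow> ('a L2_op \<times> 'a L2_op) set" where
  "mult_graph M \<phi> =
     {(integral_op M k, integral_op M (\<lambda>z. \<phi> z * k z)) | k. k \<in> mult_domain M \<phi>}"

definition norm_closure ::
    "'a measure \<Rightarrow> ('a L2_op \<times> 'a L2_op) set \<Rightarrow> ('a L2_op \<times> 'a L2_op) set" where
  "norm_closure M G =
     {(S, T). S \<in> compact_operators M \<and> T \<in> compact_operators M \<and>
        (\<forall>\<epsilon>>0. \<exists>(S', T')\<in>G. op_dist M S S' < ennreal \<epsilon> \<and> op_dist M T T' < ennreal \<epsilon>)}"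

text \<open>Graphs of linear operators that are defined on a linear subspace of the compact operators
  and have compact operators as values.\<close>

definition is_operator_graph ::
    "'a measure \<Rightarrow> ('a L2_op \<times> 'a L2_op) set \<Rightarrow> bool" where
  "is_operator_graph M G \<longleftrightarrow>
     G \<subseteq> compact_operators M \<times> compact_operators M \<and> single_valued G \<and> G \<noteq> {} \<and>
     (\<forall>(S, T)\<in>G. \<forall>(S', T')\<in>G. (op_add M S S', op_add M T T') \<in> G) \<and>
     (\<forall>c. \<forall>(S, T)\<in>G. (op_scale M c S, op_scale M c T) \<in> G)"

definition closable_multiplier :: "'a measure \<Rightarrow> ('a \<times> 'a \<Rightarrow> complex) \<Rightarrow> bool" where
  "closable_multiplier M \<phi> \<longleftrightarrow>
     \<phi> \<in> borel_measurable (M \<Otimes>\<^sub>M M) \<and> is_operator_graph M (norm_closure M (mult_graph M \<phi>))"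

text \<open>On the diagonal, which is a null set for a non-atomic measure, division by zero gives
  the value 0.\<close>

definition divided_difference :: "(real \<Rightarrow> complex) \<Rightarrow> real \<times> real \<Rightarrow> complex" where
  "divided_difference f = (\<lambda>(x, y). (f x - f y) / complex_of_real (x - y))"

end

theory Submission
  imports Defs
begin

text \<open>
  Write \<open>\<phi>\<close> for the divided difference of \<open>f\<close>. By linearity, single-valuedness of the closed graph
  means that \<open>I\<^sub>k \<longrightarrow> 0\<close> and \<open>I\<^bsub>\<phi>k\<^esub> \<longrightarrow> D\<close> in norm force \<open>D = 0\<close>. The identity
  \<open>\<phi>(x, y) (x - y) = f(x) - f(y)\<close> says that the commutator of \<open>I\<^bsub>\<phi>k\<^esub>\<close> with multiplication by the
  coordinate equals the commutator of \<open>I\<^sub>k\<close> with multiplication by \<open>f\<close>. Compressed to a set \<open>K\<close> on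
  which the coordinate and \<open>f\<close> are bounded, all multiplications are bounded operators, and the limit
  can be taken: the right-hand side tends to \<open>0\<close>, so the compression of \<open>D\<close> to \<open>L\<^sup>2(K)\<close> commutes with
  multiplication by the coordinate (\<open>compression_commutes\<close>).

  A compact operator \<open>R\<close> that commutes with multiplication by a bounded real function \<open>g\<close> and whose
  values vanish on every level set of \<open>g\<close> is zero (\<open>R_eq_zero\<close>). Indeed, comparing the growth of
  \<open>(g - t)\<^sup>m u\<close> and \<open>(g - t)\<^sup>m R u\<close> shows that \<open>R\<close> maps functions supported in \<open>{a \<le> g \<le> b}\<close> to functions
  supported there (\<open>R_support\<close>). Hence the norm of \<open>R\<close> over \<open>[a, c]\<close> is the maximum of its norms over
  \<open>[a, b]\<close> and \<open>[b, c]\<close> (\<open>bound_on_join\<close>). Over short intervals around a point \<open>t\<close> the norm is small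
  (\<open>bound_on_small\<close>): otherwise, by compactness, the images of normalised functions with supports
  shrinking to \<open>{g = t}\<close> would have a non-zero limit, which would live on that level set. By bisection
  the norm of \<open>R\<close> is as small as desired.

  In the application \<open>g\<close> is the coordinate on \<open>K\<close>, whose level sets are points and hence null sets, the
  measure being non-atomic. So the compression of \<open>D\<close> to each \<open>K\<close> vanishes, and letting \<open>K\<close> exhaust the
  interval gives \<open>D = 0\<close> (\<open>closure_limit_zero\<close>).
\<close>

section \<open>The seminorm on square integrable functions\<close>


definition sq_norm :: "'a measure \<Rightarrow> ('a \<Rightarrow> complex) \<Rightarrow> real" where
  "sq_norm M u = sqrt (\<integral>x. (cmod (u x))\<^sup>2 \<partial>M)"

lemma sq_norm_nonneg [simp]: "0 \<le> sq_norm M u"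
  by (simp add: sq_norm_def)

lemma sq_norm_power2: "(sq_norm M u)\<^sup>2 = (\<integral>x. (cmod (u x))\<^sup>2 \<partial>M)"
  by (simp add: sq_norm_def)

lemma sq_norm_zero [simp]: "sq_norm M (\<lambda>x. 0) = 0"
  by (simp add: sq_norm_def)

lemma sq_integrableD:
  assumes "u \<in> sq_integrable M"
  shows "u \<in> borel_measurable M" "integrable M (\<lambda>x. (cmod (u x))\<^sup>2)"
  using assms by (auto simp: sq_integrable_def)

lemma sq_integrable_zero [simp]: "(\<lambda>x. 0) \<in> sq_integrable M"
  by (simp add: sq_integrable_def)

lemma sq_integrable_dominated:
  assumes "u \<in> sq_integrable M" "v \<in> borel_measurable M" "AE x in M. cmod (v x) \<le> C * cmod (u x)"
    and "0 \<le> C"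
  shows "v \<in> sq_integrable M" "sq_norm M v \<le> C * sq_norm M u"
proof -
  note [measurable] = sq_integrableD(1)[OF assms(1)] assms(2)
  have le: "AE x in M. (cmod (v x))\<^sup>2 \<le> C\<^sup>2 * (cmod (u x))\<^sup>2"
    using assms(3) by eventually_elim (metis norm_ge_zero power_mono power_mult_distrib)
  have int: "integrable M (\<lambda>x. C\<^sup>2 * (cmod (u x))\<^sup>2)"
    using sq_integrableD(2)[OF assms(1)] by simp
  have int': "integrable M (\<lambda>x. (cmod (v x))\<^sup>2)"
    using le by (intro Bochner_Integration.integrable_bound[OF int]) auto
  then show "v \<in> sq_integrable M"
    using assms by (simp add: sq_integrable_def)
  have "(\<integral>x. (cmod (v x))\<^sup>2 \<partial>M) \<le> (\<integral>x. C\<^sup>2 * (cmod (u x))\<^sup>2 \<partial>M)"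
    using le int int' by (intro integral_mono_AE)
  then have "(sq_norm M v)\<^sup>2 \<le> (C * sq_norm M u)\<^sup>2"
    by (simp add: sq_norm_power2 power_mult_distrib)
  then show "sq_norm M v \<le> C * sq_norm M u"
    by (rule power2_le_imp_le) (simp add: assms(4))
qed

lemma sq_norm_cong_AE:
  assumes "u \<in> borel_measurable M" "v \<in> borel_measurable M" "AE x in M. u x = v x"
  shows "sq_norm M u = sq_norm M v"
  unfolding sq_norm_def using assms
  by (intro arg_cong[where f = sqrt] integral_cong_AE) auto

lemma AE_zero_of_sq_norm_zero:
  assumes "u \<in> sq_integrable M" "sq_norm M u = 0"
  shows "AE x in M. u x = 0"
proof -
  have "(\<integral>x. (cmod (u x))\<^sup>2 \<partial>M) = 0"
    using assms(2) by (simp add: sq_norm_def)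
  then have "AE x in M. (cmod (u x))\<^sup>2 = 0"
    using sq_integrableD(2)[OF assms(1)] by (subst (asm) integral_nonneg_eq_0_iff_AE) auto
  then show ?thesis by simp
qed

lemma sq_integrable_scale:
  assumes "u \<in> sq_integrable M"
  shows "(\<lambda>x. c * u x) \<in> sq_integrable M"
  using sq_integrableD[OF assms] by (auto simp: sq_integrable_def norm_mult power_mult_distrib)

lemma sq_norm_scale: "sq_norm M (\<lambda>x. c * u x) = cmod c * sq_norm M u"
  by (simp add: sq_norm_def norm_mult power_mult_distrib real_sqrt_mult)

lemma sq_integrable_product:
  assumes "u \<in> sq_integrable M" "v \<in> sq_integrable M"
  shows "integrable M (\<lambda>x. u x * v x)"
proof -
  note [measurable] = sq_integrableD(1)[OF assms(1)] sq_integrableD(1)[OF assms(2)]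
  have "integrable M (\<lambda>x. (cmod (u x))\<^sup>2 + (cmod (v x))\<^sup>2)"
    using assms by (intro Bochner_Integration.integrable_add sq_integrableD)
  then show ?thesis
  proof (rule Bochner_Integration.integrable_bound)
    have "cmod (u x * v x) \<le> (cmod (u x))\<^sup>2 + (cmod (v x))\<^sup>2" for x
      using sum_squares_bound[of "cmod (u x)" "cmod (v x)"]
        zero_le_power2[of "cmod (u x)"] zero_le_power2[of "cmod (v x)"]
      unfolding norm_mult by linarith
    then show "AE x in M. norm (u x * v x) \<le> norm ((cmod (u x))\<^sup>2 + (cmod (v x))\<^sup>2)"
      by (metis (mono_tags, lifting) AE_I2 abs_of_nonneg add_nonneg_nonneg real_norm_def zero_le_power2)
  qed simp
qed

text \<open>The integral of \<open>(t |u| - |v|)\<^sup>2\<close> is a non-negative quadratic polynomial in \<open>t\<close>; the inequality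
  is read off at its minimum.\<close>

lemma Cauchy_Schwarz_sq_norm:
  assumes "u \<in> sq_integrable M" "v \<in> sq_integrable M"
  shows "(\<integral>x. cmod (u x) * cmod (v x) \<partial>M) \<le> sq_norm M u * sq_norm M v"
proof -
  define A where "A = (\<integral>x. (cmod (u x))\<^sup>2 \<partial>M)"
  define B where "B = (\<integral>x. (cmod (v x))\<^sup>2 \<partial>M)"
  define P where "P = (\<integral>x. cmod (u x) * cmod (v x) \<partial>M)"
  note int [simp] = sq_integrableD(2)[OF assms(1)] sq_integrableD(2)[OF assms(2)]
  have intP [simp]: "integrable M (\<lambda>x. cmod (u x) * cmod (v x))"
    using integrable_norm[OF sq_integrable_product[OF assms]] by (simp add: norm_mult)
  have "0 \<le> A" "0 \<le> B"
    by (simp_all add: A_def B_def)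
  have quadratic: "0 \<le> t\<^sup>2 * A - 2 * t * P + B" for t
  proof -
    have "0 \<le> (\<integral>x. (t * cmod (u x) - cmod (v x))\<^sup>2 \<partial>M)" by simp
    also have "\<dots> = (\<integral>x. t\<^sup>2 * (cmod (u x))\<^sup>2 - 2 * t * (cmod (u x) * cmod (v x)) + (cmod (v x))\<^sup>2 \<partial>M)"
      by (simp add: power2_diff power_mult_distrib algebra_simps)
    also have "\<dots> = t\<^sup>2 * A - 2 * t * P + B"
      by (simp add: A_def B_def P_def)
    finally show ?thesis by simp
  qed
  have "P\<^sup>2 \<le> A * B"
  proof (cases "A = 0")
    case True
    \<comment> \<open>The polynomial is then affine, and this \<open>t\<close> makes it negative unless \<open>P\<close> vanishes.\<close>
    have "P = 0"
    proof (rule ccontr)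
      assume "P \<noteq> 0"
      then show False
        using quadratic[of "(B + 1) / (2 * P)"] True by simp
    qed
    then show ?thesis using True by simp
  next
    case False
    with \<open>0 \<le> A\<close> have "0 < A" by simp
    have "0 \<le> A * ((P / A)\<^sup>2 * A - 2 * (P / A) * P + B)"
      using quadratic[of "P / A"] \<open>0 < A\<close> by simp
    also have "\<dots> = A * B - P\<^sup>2"
      using \<open>0 < A\<close> by (simp add: field_simps power2_eq_square)
    finally show ?thesis by simp
  qed
  then have "P \<le> sqrt (A * B)"
    by (simp add: real_le_rsqrt)
  then show ?thesis
    by (simp add: A_def B_def P_def sq_norm_def real_sqrt_mult)
qed

lemma
  assumes "u \<in> sq_integrable M" "v \<in> sq_integrable M"
  shows sq_integrable_add: "(\<lambda>x. u x + v x) \<in> sq_integrable M"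
    and sq_norm_triangle: "sq_norm M (\<lambda>x. u x + v x) \<le> sq_norm M u + sq_norm M v"
proof -
  note [measurable] = sq_integrableD(1)[OF assms(1)] sq_integrableD(1)[OF assms(2)]
  note int [simp] = sq_integrableD(2)[OF assms(1)] sq_integrableD(2)[OF assms(2)]
  have intP [simp]: "integrable M (\<lambda>x. cmod (u x) * cmod (v x))"
    using integrable_norm[OF sq_integrable_product[OF assms]] by (simp add: norm_mult)
  let ?h = "\<lambda>x. (cmod (u x))\<^sup>2 + (cmod (v x))\<^sup>2 + 2 * (cmod (u x) * cmod (v x))"
  have le: "(cmod (u x + v x))\<^sup>2 \<le> ?h x" for x
    using power_mono[OF norm_triangle_ineq[of "u x" "v x"] norm_ge_zero, of 2]
    by (simp add: power2_sum)
  have inth: "integrable M ?h" by simp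
  have int': "integrable M (\<lambda>x. (cmod (u x + v x))\<^sup>2)"
    using le by (intro Bochner_Integration.integrable_bound[OF inth]) auto
  then show "(\<lambda>x. u x + v x) \<in> sq_integrable M"
    by (simp add: sq_integrable_def)
  have "(\<integral>x. (cmod (u x + v x))\<^sup>2 \<partial>M) \<le> (\<integral>x. ?h x \<partial>M)"
    using inth int' le by (intro integral_mono)
  also have "\<dots> = (sq_norm M u)\<^sup>2 + (sq_norm M v)\<^sup>2 + 2 * (\<integral>x. cmod (u x) * cmod (v x) \<partial>M)"
    by (simp add: sq_norm_power2)
  also have "\<dots> \<le> (sq_norm M u)\<^sup>2 + (sq_norm M v)\<^sup>2 + 2 * (sq_norm M u * sq_norm M v)"
    using Cauchy_Schwarz_sq_norm[OF assms] by simp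
  also have "\<dots> = (sq_norm M u + sq_norm M v)\<^sup>2"
    by (simp add: power2_sum)
  finally show "sq_norm M (\<lambda>x. u x + v x) \<le> sq_norm M u + sq_norm M v"
    unfolding sq_norm_power2[symmetric] by (rule power2_le_imp_le) simp
qed

lemma sq_integrable_diff:
  assumes "u \<in> sq_integrable M" "v \<in> sq_integrable M"
  shows "(\<lambda>x. u x - v x) \<in> sq_integrable M"
  using sq_integrable_add[OF assms(1) sq_integrable_scale[OF assms(2), of "-1"]] by simp

lemma sq_norm_triangle_diff:
  assumes "u \<in> sq_integrable M" "v \<in> sq_integrable M"
  shows "sq_norm M (\<lambda>x. u x - v x) \<le> sq_norm M u + sq_norm M v"
proof -
  have "sq_norm M (\<lambda>x. u x + - 1 * v x) \<le> sq_norm M u + sq_norm M (\<lambda>x. - 1 * v x)"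
    by (rule sq_norm_triangle[OF assms(1) sq_integrable_scale[OF assms(2), of "-1"]])
  then show ?thesis
    unfolding sq_norm_scale by simp
qed

lemma
  assumes "u \<in> sq_integrable M" "h \<in> borel_measurable M" "\<And>x. cmod (h x) \<le> C"
  shows sq_integrable_bounded_mult: "(\<lambda>x. h x * u x) \<in> sq_integrable M"
    and sq_norm_bounded_mult: "sq_norm M (\<lambda>x. h x * u x) \<le> C * sq_norm M u"
proof -
  note [measurable] = sq_integrableD(1)[OF assms(1)] assms(2)
  have "AE x in M. cmod (h x * u x) \<le> C * cmod (u x)"
    using assms(3) by (simp add: norm_mult mult_right_mono)
  moreover have "0 \<le> C"
    by (rule order_trans[OF norm_ge_zero assms(3)])
  ultimately show "(\<lambda>x. h x * u x) \<in> sq_integrable M" "sq_norm M (\<lambda>x. h x * u x) \<le> C * sq_norm M u"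
    using sq_integrable_dominated[OF assms(1), of "\<lambda>x. h x * u x" C] by auto
qed

section \<open>Operators on classes, read on functions\<close>

lemma L2_rep_in_sq_integrable:
  assumes "a \<in> L2 M"
  shows "L2_rep a \<in> sq_integrable M" "L2_class M (L2_rep a) = a"
proof -
  obtain f where f: "f \<in> sq_integrable M" "a = L2_class M f"
    using assms by (auto simp: L2_def L2_class_def quotient_def)
  show "L2_rep a \<in> sq_integrable M"
    using L2_rep_class(1)[OF f(1)] f(2) by simp
  show "L2_class M (L2_rep a) = a"
    unfolding f(2) by (rule L2_class_cong) (use L2_rep_class[OF f(1)] f(1) in \<open>auto intro: sq_integrable_measurable\<close>)
qed

lemma L2_norm_class_eq_sq_norm:
  assumes "u \<in> sq_integrable M"
  shows "L2_norm M (L2_class M u) = sq_norm M u"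
  using L2_norm_class[OF assms] by (simp add: sq_norm_def)

lemma L2_dist_class:
  assumes "u \<in> sq_integrable M" "v \<in> sq_integrable M"
  shows "L2_norm M (L2_add M (L2_class M u) (L2_scale M (-1) (L2_class M v))) = sq_norm M (\<lambda>x. u x - v x)"
  using assms sq_integrable_diff[OF assms] sq_integrable_scale[OF assms(2), of "-1"]
  by (simp add: L2_scale_class L2_add_class L2_norm_class_eq_sq_norm)

text \<open>All analysis below is done with functions. \<open>fun_op M T\<close> is \<open>T\<close> read on representatives; its values
  are determined up to null sets, so its algebraic laws hold almost everywhere.\<close>

definition fun_op :: "'a measure \<Rightarrow> 'a L2_op \<Rightarrow> ('a \<Rightarrow> complex) \<Rightarrow> 'a \<Rightarrow> complex" where
  "fun_op M T u = L2_rep (T (L2_class M u))"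

lemma L2_linear_PiE: "L2_linear M T \<Longrightarrow> T \<in> L2 M \<rightarrow>\<^sub>E L2 M"
  by (simp add: L2_linear_def)

lemma
  assumes "T \<in> L2 M \<rightarrow>\<^sub>E L2 M" "u \<in> sq_integrable M"
  shows fun_op_sq_integrable: "fun_op M T u \<in> sq_integrable M"
    and L2_class_fun_op: "L2_class M (fun_op M T u) = T (L2_class M u)"
proof -
  have "T (L2_class M u) \<in> L2 M"
    using assms by (auto intro!: L2_class_in_L2)
  then show "fun_op M T u \<in> sq_integrable M" "L2_class M (fun_op M T u) = T (L2_class M u)"
    by (simp_all add: fun_op_def L2_rep_in_sq_integrable)
qed

lemma fun_op_AE_eq:
  assumes "T (L2_class M u) = L2_class M v" "v \<in> sq_integrable M"
  shows "AE x in M. fun_op M T u x = v x"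
  using L2_rep_class(2)[OF assms(2)] assms(1) by (simp add: fun_op_def)

lemma fun_op_add:
  assumes "L2_linear M T" "u \<in> sq_integrable M" "v \<in> sq_integrable M"
  shows "AE x in M. fun_op M T (\<lambda>x. u x + v x) x = fun_op M T u x + fun_op M T v x"
proof (rule fun_op_AE_eq)
  note T = L2_linear_PiE[OF assms(1)]
  show "(\<lambda>x. fun_op M T u x + fun_op M T v x) \<in> sq_integrable M"
    using T assms by (simp add: sq_integrable_add fun_op_sq_integrable)
  have "T (L2_class M (\<lambda>x. u x + v x)) = L2_add M (T (L2_class M u)) (T (L2_class M v))"
    using assms by (simp add: L2_add_class[symmetric] L2_linear_def L2_class_in_L2)
  then show "T (L2_class M (\<lambda>x. u x + v x)) = L2_class M (\<lambda>x. fun_op M T u x + fun_op M T v x)"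
    using assms T by (simp add: L2_class_fun_op[symmetric] L2_add_class fun_op_sq_integrable)
qed

lemma fun_op_scale:
  assumes "L2_linear M T" "u \<in> sq_integrable M"
  shows "AE x in M. fun_op M T (\<lambda>x. c * u x) x = c * fun_op M T u x"
proof (rule fun_op_AE_eq)
  note T = L2_linear_PiE[OF assms(1)]
  show "(\<lambda>x. c * fun_op M T u x) \<in> sq_integrable M"
    using T assms by (simp add: sq_integrable_scale fun_op_sq_integrable)
  have "T (L2_class M (\<lambda>x. c * u x)) = L2_scale M c (T (L2_class M u))"
    using assms by (simp add: L2_scale_class[symmetric] L2_linear_def L2_class_in_L2)
  then show "T (L2_class M (\<lambda>x. c * u x)) = L2_class M (\<lambda>x. c * fun_op M T u x)"
    using assms T by (simp add: L2_class_fun_op[symmetric] L2_scale_class fun_op_sq_integrable)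
qed

lemma L2_op_eqI:
  assumes "S \<in> L2 M \<rightarrow>\<^sub>E L2 M" "T \<in> L2 M \<rightarrow>\<^sub>E L2 M"
    and "\<And>u. u \<in> sq_integrable M \<Longrightarrow> AE x in M. fun_op M S u x = fun_op M T u x"
  shows "S = T"
proof (rule PiE_ext[OF assms(1,2)])
  fix a assume "a \<in> L2 M"
  note a = L2_rep_in_sq_integrable[OF this]
  have "L2_class M (fun_op M S (L2_rep a)) = L2_class M (fun_op M T (L2_rep a))"
    using assms a by (intro L2_class_cong) (auto intro!: sq_integrable_measurable fun_op_sq_integrable)
  then show "S a = T a"
    using a assms by (simp add: L2_class_fun_op)
qed

lemma L2_linearI:
  assumes "T \<in> L2 M \<rightarrow>\<^sub>E L2 M"
    and "\<And>u v. u \<in> sq_integrable M \<Longrightarrow> v \<in> sq_integrable M \<Longrightarrow>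
      AE x in M. fun_op M T (\<lambda>x. u x + v x) x = fun_op M T u x + fun_op M T v x"
    and "\<And>c u. u \<in> sq_integrable M \<Longrightarrow> AE x in M. fun_op M T (\<lambda>x. c * u x) x = c * fun_op M T u x"
  shows "L2_linear M T"
proof -
  have sq [simp]: "fun_op M T u \<in> sq_integrable M" "fun_op M T u \<in> borel_measurable M"
    if "u \<in> sq_integrable M" for u
    using fun_op_sq_integrable[OF assms(1) that] sq_integrable_measurable by auto
  have "T (L2_add M (L2_class M u) (L2_class M v)) = L2_add M (T (L2_class M u)) (T (L2_class M v))"
    if uv: "u \<in> sq_integrable M" "v \<in> sq_integrable M" for u v
  proof -
    have "L2_class M (fun_op M T (\<lambda>x. u x + v x)) = L2_class M (\<lambda>x. fun_op M T u x + fun_op M T v x)"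
      using assms(2)[OF uv] uv sq_integrable_add[OF uv]
      by (intro L2_class_cong borel_measurable_add) auto
    then show ?thesis
      using uv assms(1) sq_integrable_add[OF uv]
      by (simp add: L2_add_class L2_class_fun_op[symmetric])
  qed
  moreover have "T (L2_scale M c (L2_class M u)) = L2_scale M c (T (L2_class M u))"
    if u: "u \<in> sq_integrable M" for c u
  proof -
    have "L2_class M (fun_op M T (\<lambda>x. c * u x)) = L2_class M (\<lambda>x. c * fun_op M T u x)"
      using assms(3)[OF u] u sq_integrable_scale[OF u]
      by (intro L2_class_cong borel_measurable_times) auto
    then show ?thesis
      using u assms(1) sq_integrable_scale[OF u]
      by (simp add: L2_scale_class L2_class_fun_op[symmetric])
  qed
  ultimately show ?thesis
    unfolding L2_linear_def using assms(1)
    by (metis L2_rep_in_sq_integrable)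
qed

lemma
  assumes "S \<in> L2 M \<rightarrow>\<^sub>E L2 M" "T \<in> L2 M \<rightarrow>\<^sub>E L2 M"
  shows op_add_PiE: "op_add M S T \<in> L2 M \<rightarrow>\<^sub>E L2 M"
    and fun_op_op_add: "u \<in> sq_integrable M \<Longrightarrow>
      AE x in M. fun_op M (op_add M S T) u x = fun_op M S u x + fun_op M T u x"
proof -
  have add: "L2_add M (S (L2_class M u)) (T (L2_class M u)) = L2_class M (\<lambda>x. fun_op M S u x + fun_op M T u x)"
    "(\<lambda>x. fun_op M S u x + fun_op M T u x) \<in> sq_integrable M"
    if "u \<in> sq_integrable M" for u
    using that assms
    by (simp_all add: L2_class_fun_op[symmetric] L2_add_class fun_op_sq_integrable sq_integrable_add)
  have "L2_add M (S a) (T a) \<in> L2 M" if "a \<in> L2 M" for a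
    using add[of "L2_rep a"] L2_rep_in_sq_integrable[OF that] L2_class_in_L2 by metis
  then show "op_add M S T \<in> L2 M \<rightarrow>\<^sub>E L2 M"
    by (simp add: op_add_def)
  show "AE x in M. fun_op M (op_add M S T) u x = fun_op M S u x + fun_op M T u x"
    if "u \<in> sq_integrable M"
    using that add by (intro fun_op_AE_eq) (simp_all add: op_add_def L2_class_in_L2)
qed

lemma
  assumes "T \<in> L2 M \<rightarrow>\<^sub>E L2 M"
  shows op_scale_PiE: "op_scale M c T \<in> L2 M \<rightarrow>\<^sub>E L2 M"
    and fun_op_op_scale: "u \<in> sq_integrable M \<Longrightarrow>
      AE x in M. fun_op M (op_scale M c T) u x = c * fun_op M T u x"
proof -
  have scale: "L2_scale M c (T (L2_class M u)) = L2_class M (\<lambda>x. c * fun_op M T u x)"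
    "(\<lambda>x. c * fun_op M T u x) \<in> sq_integrable M"
    if "u \<in> sq_integrable M" for u
    using that assms
    by (simp_all add: L2_class_fun_op[symmetric] L2_scale_class fun_op_sq_integrable sq_integrable_scale)
  have "L2_scale M c (T a) \<in> L2 M" if "a \<in> L2 M" for a
    using scale[of "L2_rep a"] L2_rep_in_sq_integrable[OF that] L2_class_in_L2 by metis
  then show "op_scale M c T \<in> L2 M \<rightarrow>\<^sub>E L2 M"
    by (simp add: op_scale_def)
  show "AE x in M. fun_op M (op_scale M c T) u x = c * fun_op M T u x"
    if "u \<in> sq_integrable M"
    using that scale by (intro fun_op_AE_eq) (simp_all add: op_scale_def L2_class_in_L2)
qed

lemma L2_linear_op_add:
  assumes "L2_linear M S" "L2_linear M T"
  shows "L2_linear M (op_add M S T)"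
proof (rule L2_linearI)
  note ST = assms[THEN L2_linear_PiE]
  show "op_add M S T \<in> L2 M \<rightarrow>\<^sub>E L2 M"
    by (rule op_add_PiE[OF ST])
  fix u v c assume u: "u \<in> sq_integrable M"
  show "AE x in M. fun_op M (op_add M S T) (\<lambda>x. c * u x) x = c * fun_op M (op_add M S T) u x"
    using fun_op_op_add[OF ST sq_integrable_scale[OF u, of c]] fun_op_op_add[OF ST u]
      fun_op_scale[OF assms(1) u, of c] fun_op_scale[OF assms(2) u, of c]
    by eventually_elim (simp add: algebra_simps)
  assume v: "v \<in> sq_integrable M"
  show "AE x in M. fun_op M (op_add M S T) (\<lambda>x. u x + v x) x
      = fun_op M (op_add M S T) u x + fun_op M (op_add M S T) v x"
    using fun_op_op_add[OF ST sq_integrable_add[OF u v]] fun_op_op_add[OF ST u] fun_op_op_add[OF ST v]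
      fun_op_add[OF assms(1) u v] fun_op_add[OF assms(2) u v]
    by eventually_elim simp
qed

lemma L2_linear_op_scale:
  assumes "L2_linear M T"
  shows "L2_linear M (op_scale M c T)"
proof (rule L2_linearI)
  note T = assms[THEN L2_linear_PiE]
  show "op_scale M c T \<in> L2 M \<rightarrow>\<^sub>E L2 M"
    by (rule op_scale_PiE[OF T])
  fix u v d assume u: "u \<in> sq_integrable M"
  show "AE x in M. fun_op M (op_scale M c T) (\<lambda>x. d * u x) x = d * fun_op M (op_scale M c T) u x"
    using fun_op_op_scale[OF T sq_integrable_scale[OF u, of d], of c] fun_op_op_scale[OF T u, of c]
      fun_op_scale[OF assms u, of d]
    by eventually_elim simp
  assume v: "v \<in> sq_integrable M"
  show "AE x in M. fun_op M (op_scale M c T) (\<lambda>x. u x + v x) x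
      = fun_op M (op_scale M c T) u x + fun_op M (op_scale M c T) v x"
    using fun_op_op_scale[OF T sq_integrable_add[OF u v], of c] fun_op_op_scale[OF T u, of c]
      fun_op_op_scale[OF T v, of c] fun_op_add[OF assms u v]
    by eventually_elim (simp add: algebra_simps)
qed

lemma L2_norm_op_dist:
  assumes "S \<in> L2 M \<rightarrow>\<^sub>E L2 M" "T \<in> L2 M \<rightarrow>\<^sub>E L2 M" "u \<in> sq_integrable M"
  shows "L2_norm M (op_add M S (op_scale M (-1) T) (L2_class M u))
    = sq_norm M (\<lambda>x. fun_op M S u x - fun_op M T u x)"
proof -
  have "op_add M S (op_scale M (-1) T) (L2_class M u)
      = L2_add M (L2_class M (fun_op M S u)) (L2_scale M (-1) (L2_class M (fun_op M T u)))"
    using assms by (simp add: op_add_def op_scale_def L2_class_in_L2 L2_class_fun_op)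
  then show ?thesis
    using assms by (simp add: L2_dist_class fun_op_sq_integrable)
qed

lemma op_dist_leI:
  assumes "S \<in> L2 M \<rightarrow>\<^sub>E L2 M" "T \<in> L2 M \<rightarrow>\<^sub>E L2 M" "0 \<le> e"
    and "\<And>u. u \<in> sq_integrable M \<Longrightarrow>
      sq_norm M (\<lambda>x. fun_op M S u x - fun_op M T u x) \<le> e * sq_norm M u"
  shows "op_dist M S T \<le> ennreal e"
  unfolding op_dist_def op_norm_def
proof (rule SUP_least)
  fix a assume "a \<in> {a \<in> L2 M. L2_norm M a \<le> 1}"
  then have a: "a \<in> L2 M" "L2_norm M a \<le> 1" by auto
  note r = L2_rep_in_sq_integrable[OF a(1)]
  have "L2_norm M (op_add M S (op_scale M (-1) T) a) \<le> e * sq_norm M (L2_rep a)"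
    using L2_norm_op_dist[OF assms(1,2) r(1)] assms(4)[OF r(1)] r(2) by simp
  also have "\<dots> \<le> e * 1"
    using L2_norm_class_eq_sq_norm[OF r(1)] r(2) a(2) assms(3) by (intro mult_left_mono) auto
  finally show "ennreal (L2_norm M (op_add M S (op_scale M (-1) T) a)) \<le> ennreal e"
    by (simp add: ennreal_leI)
qed

text \<open>The operator norm only looks at the unit ball. Homogeneity extends the bound to all \<^term>\<open>u\<close>; if the
  seminorm of \<^term>\<open>u\<close> vanishes, all multiples of \<^term>\<open>u\<close> lie in the unit ball and the difference of
  the images must vanish too.\<close>

lemma op_dist_lessD:
  assumes "L2_linear M S" "L2_linear M T" "op_dist M S T < ennreal e" "u \<in> sq_integrable M"
  shows "sq_norm M (\<lambda>x. fun_op M S u x - fun_op M T u x) \<le> e * sq_norm M u"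
proof -
  note ST = assms(1,2)[THEN L2_linear_PiE]
  have "0 < e"
    using assms(3) by (metis ennreal_neg not_less zero_le not_le)
  have sq [simp]: "fun_op M S v \<in> sq_integrable M" "fun_op M T v \<in> sq_integrable M"
    if "v \<in> sq_integrable M" for v
    using fun_op_sq_integrable ST that by auto
  have scaled: "sq_norm M (\<lambda>x. fun_op M S (\<lambda>x. c * u x) x - fun_op M T (\<lambda>x. c * u x) x)
      = cmod c * sq_norm M (\<lambda>x. fun_op M S u x - fun_op M T u x)" for c
  proof -
    note cu = sq_integrable_scale[OF assms(4), of c]
    have "sq_norm M (\<lambda>x. fun_op M S (\<lambda>x. c * u x) x - fun_op M T (\<lambda>x. c * u x) x)
        = sq_norm M (\<lambda>x. c * (fun_op M S u x - fun_op M T u x))"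
    proof (rule sq_norm_cong_AE)
      show "AE x in M. fun_op M S (\<lambda>x. c * u x) x - fun_op M T (\<lambda>x. c * u x) x
          = c * (fun_op M S u x - fun_op M T u x)"
        using fun_op_scale[OF assms(1,4), of c] fun_op_scale[OF assms(2,4), of c]
        by eventually_elim (simp add: algebra_simps)
    qed (use cu assms(4) in \<open>auto intro!: sq_integrable_measurable sq_integrable_diff sq_integrable_scale\<close>)
    then show ?thesis by (simp add: sq_norm_scale)
  qed
  have unit: "sq_norm M (\<lambda>x. fun_op M S v x - fun_op M T v x) \<le> e"
    if v: "v \<in> sq_integrable M" "sq_norm M v \<le> 1" for v
  proof -
    have "L2_class M v \<in> {a \<in> L2 M. L2_norm M a \<le> 1}"
      using v by (simp add: L2_class_in_L2 L2_norm_class_eq_sq_norm)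
    then have "ennreal (L2_norm M (op_add M S (op_scale M (-1) T) (L2_class M v))) \<le> op_dist M S T"
      unfolding op_dist_def op_norm_def by (rule SUP_upper)
    then show ?thesis
      using L2_norm_op_dist[OF ST v(1)] assms(3) \<open>0 < e\<close>
      by (metis ennreal_less_iff le_less_trans less_imp_le sq_norm_nonneg)
  qed
  show ?thesis
  proof (cases "sq_norm M u = 0")
    case True
    have "cmod c * sq_norm M (\<lambda>x. fun_op M S u x - fun_op M T u x) \<le> e" for c
      using unit[OF sq_integrable_scale[OF assms(4), of c]] scaled[of c] True
      by (simp add: sq_norm_scale)
    from this[of "complex_of_real ((e + 1) / sq_norm M (\<lambda>x. fun_op M S u x - fun_op M T u x))"]
    show ?thesis
      using True \<open>0 < e\<close> by (cases "sq_norm M (\<lambda>x. fun_op M S u x - fun_op M T u x) = 0")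
        (auto simp: norm_divide)
  next
    case False
    then have "0 < sq_norm M u"
      by (simp add: less_le)
    define c where "c = complex_of_real (1 / sq_norm M u)"
    have c: "cmod c = 1 / sq_norm M u"
      by (simp add: c_def norm_divide)
    have "cmod c * sq_norm M (\<lambda>x. fun_op M S u x - fun_op M T u x) \<le> e"
      using unit[OF sq_integrable_scale[OF assms(4), of c]] scaled[of c] False
      by (simp add: sq_norm_scale c)
    then show ?thesis
      using \<open>0 < sq_norm M u\<close> by (simp add: c field_simps)
  qed
qed

section \<open>Compact operators in terms of functions\<close>

lemma compact_operators_iff:
  "T \<in> compact_operators M \<longleftrightarrow> L2_linear M T \<and>
    (\<forall>u. (\<forall>n. u n \<in> sq_integrable M) \<longrightarrow> (\<exists>C. \<forall>n. sq_norm M (u n) \<le> C) \<longrightarrow>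
      (\<exists>r v. strict_mono (r :: nat \<Rightarrow> nat) \<and> v \<in> sq_integrable M \<and>
        (\<lambda>n. sq_norm M (\<lambda>x. fun_op M T (u (r n)) x - v x)) \<longlonglongrightarrow> 0))"
    (is "_ \<longleftrightarrow> _ \<and> ?compact")
proof (cases "L2_linear M T")
  case True
  note T = L2_linear_PiE[OF True]
  have dist: "L2_norm M (L2_add M (T (L2_class M u)) (L2_scale M (-1) (L2_class M v)))
      = sq_norm M (\<lambda>x. fun_op M T u x - v x)"
    if "u \<in> sq_integrable M" "v \<in> sq_integrable M" for u v
    using that T by (simp add: L2_class_fun_op[symmetric] L2_dist_class fun_op_sq_integrable)
  have "T \<in> compact_operators M \<longleftrightarrow> ?compact"
  proof
    assume comp: "T \<in> compact_operators M"
    show ?compact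
    proof (intro allI impI)
      fix u :: "nat \<Rightarrow> _" assume u: "\<forall>n. u n \<in> sq_integrable M" "\<exists>C. \<forall>n. sq_norm M (u n) \<le> C"
      have "range (\<lambda>n. L2_class M (u n)) \<subseteq> L2 M" "\<exists>C. \<forall>n. L2_norm M (L2_class M (u n)) \<le> C"
        using u by (auto simp: L2_class_in_L2 L2_norm_class_eq_sq_norm)
      with comp obtain r b where r: "strict_mono (r :: nat \<Rightarrow> nat)" "b \<in> L2 M"
        "(\<lambda>n. L2_norm M (L2_add M (T (L2_class M (u (r n)))) (L2_scale M (-1) b))) \<longlonglongrightarrow> 0"
        unfolding compact_operators_def by blast
      note b = L2_rep_in_sq_integrable[OF r(2)]
      show "\<exists>r v. strict_mono (r :: nat \<Rightarrow> nat) \<and> v \<in> sq_integrable M \<and>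
          (\<lambda>n. sq_norm M (\<lambda>x. fun_op M T (u (r n)) x - v x)) \<longlonglongrightarrow> 0"
        using r b(1) dist[of "u (r _)" "L2_rep b"] u(1) b(2)
        by (intro exI[of _ r] exI[of _ "L2_rep b"]) simp
    qed
  next
    assume comp: ?compact
    have "\<exists>r b. strict_mono (r :: nat \<Rightarrow> nat) \<and> b \<in> L2 M \<and>
        (\<lambda>n. L2_norm M (L2_add M (T (a (r n))) (L2_scale M (-1) b))) \<longlonglongrightarrow> 0"
      if a: "range a \<subseteq> L2 M" "\<exists>C. \<forall>n. L2_norm M (a n) \<le> C" for a :: "nat \<Rightarrow> _"
    proof -
      have rep: "L2_rep (a n) \<in> sq_integrable M" "L2_class M (L2_rep (a n)) = a n" for n
        using a(1) by (auto intro!: L2_rep_in_sq_integrable)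
      have "\<exists>C. \<forall>n. sq_norm M (L2_rep (a n)) \<le> C"
        using a(2) L2_norm_class_eq_sq_norm[OF rep(1)] rep(2) by simp
      then obtain r v where r: "strict_mono (r :: nat \<Rightarrow> nat)" "v \<in> sq_integrable M"
        "(\<lambda>n. sq_norm M (\<lambda>x. fun_op M T (L2_rep (a (r n))) x - v x)) \<longlonglongrightarrow> 0"
        using comp[rule_format, of "\<lambda>n. L2_rep (a n)"] rep(1) by blast
      then show ?thesis
        using dist[OF rep(1) r(2)] rep(2)
        by (intro exI[of _ r] exI[of _ "L2_class M v"]) (simp add: L2_class_in_L2)
    qed
    then show "T \<in> compact_operators M"
      using True unfolding compact_operators_def by blast
  qed
  then show ?thesis using True by simp
qed (simp add: compact_operators_def)

lemma compact_operators_L2_linear: "T \<in> compact_operators M \<Longrightarrow> L2_linear M T"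
  by (simp add: compact_operators_def)

lemma compact_operators_subseq:
  assumes "T \<in> compact_operators M" "\<And>n. u n \<in> sq_integrable M" "\<And>n. sq_norm M (u n) \<le> C"
  obtains r v where "strict_mono (r :: nat \<Rightarrow> nat)" "v \<in> sq_integrable M"
    "(\<lambda>n. sq_norm M (\<lambda>x. fun_op M T (u (r n)) x - v x)) \<longlonglongrightarrow> 0"
  using assms unfolding compact_operators_iff by meson

lemma compact_operators_op_scale:
  assumes "T \<in> compact_operators M"
  shows "op_scale M c T \<in> compact_operators M"
  unfolding compact_operators_iff
proof (intro conjI allI impI)
  note lin = compact_operators_L2_linear[OF assms]
  note T = L2_linear_PiE[OF lin]
  show "L2_linear M (op_scale M c T)"
    by (rule L2_linear_op_scale[OF lin])
  fix u :: "nat \<Rightarrow> _" assume u: "\<forall>n. u n \<in> sq_integrable M" "\<exists>C. \<forall>n. sq_norm M (u n) \<le> C"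
  then obtain C where C: "\<And>n. sq_norm M (u n) \<le> C" by blast
  obtain r v where r: "strict_mono (r :: nat \<Rightarrow> nat)" and v: "v \<in> sq_integrable M"
    and lim: "(\<lambda>n. sq_norm M (\<lambda>x. fun_op M T (u (r n)) x - v x)) \<longlonglongrightarrow> 0"
    by (rule compact_operators_subseq[OF assms u(1)[rule_format] C])
  have "sq_norm M (\<lambda>x. fun_op M (op_scale M c T) (u (r n)) x - c * v x)
      = cmod c * sq_norm M (\<lambda>x. fun_op M T (u (r n)) x - v x)" for n
  proof -
    note un = u(1)[rule_format, of "r n"]
    note [measurable] = sq_integrable_measurable[OF v]
      sq_integrable_measurable[OF fun_op_sq_integrable[OF T un]]
      sq_integrable_measurable[OF fun_op_sq_integrable[OF op_scale_PiE[OF T] un]]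
    have "sq_norm M (\<lambda>x. fun_op M (op_scale M c T) (u (r n)) x - c * v x)
      = sq_norm M (\<lambda>x. c * (fun_op M T (u (r n)) x - v x))"
      using fun_op_op_scale[OF T un, of c]
      by (intro sq_norm_cong_AE) (auto simp: algebra_simps)
    then show ?thesis by (simp add: sq_norm_scale)
  qed
  then show "\<exists>r v. strict_mono (r :: nat \<Rightarrow> nat) \<and> v \<in> sq_integrable M \<and>
      (\<lambda>n. sq_norm M (\<lambda>x. fun_op M (op_scale M c T) (u (r n)) x - v x)) \<longlonglongrightarrow> 0"
    using r sq_integrable_scale[OF v, of c] tendsto_mult_right_zero[OF lim, of "cmod c"]
    by (intro exI[of _ r] exI[of _ "\<lambda>x. c * v x"]) simp
qed

lemma compact_operators_op_add:
  assumes "S \<in> compact_operators M" "T \<in> compact_operators M"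
  shows "op_add M S T \<in> compact_operators M"
  unfolding compact_operators_iff
proof (intro conjI allI impI)
  note lin = assms[THEN compact_operators_L2_linear]
  note ST = lin[THEN L2_linear_PiE]
  show "L2_linear M (op_add M S T)"
    by (rule L2_linear_op_add[OF lin])
  fix u :: "nat \<Rightarrow> _" assume u: "\<forall>n. u n \<in> sq_integrable M" "\<exists>C. \<forall>n. sq_norm M (u n) \<le> C"
  then obtain C where C: "\<And>n. sq_norm M (u n) \<le> C" by blast
  obtain r v where r: "strict_mono (r :: nat \<Rightarrow> nat)" and v: "v \<in> sq_integrable M"
    and lim: "(\<lambda>n. sq_norm M (\<lambda>x. fun_op M S (u (r n)) x - v x)) \<longlonglongrightarrow> 0"
    by (rule compact_operators_subseq[OF assms(1) u(1)[rule_format] C])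
  obtain q w where q: "strict_mono (q :: nat \<Rightarrow> nat)" and w: "w \<in> sq_integrable M"
    and lim': "(\<lambda>n. sq_norm M (\<lambda>x. fun_op M T (u (r (q n))) x - w x)) \<longlonglongrightarrow> 0"
    by (rule compact_operators_subseq[OF assms(2) u(1)[rule_format] C])
  have bound: "sq_norm M (\<lambda>x. fun_op M (op_add M S T) (u (r (q n))) x - (v x + w x))
      \<le> sq_norm M (\<lambda>x. fun_op M S (u (r (q n))) x - v x)
        + sq_norm M (\<lambda>x. fun_op M T (u (r (q n))) x - w x)" for n
  proof -
    note un = u(1)[rule_format, of "r (q n)"]
    note sqS = fun_op_sq_integrable[OF ST(1) un] and sqT = fun_op_sq_integrable[OF ST(2) un]
    note [measurable] = v[THEN sq_integrable_measurable] w[THEN sq_integrable_measurable]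
      sqS[THEN sq_integrable_measurable] sqT[THEN sq_integrable_measurable]
      sq_integrable_measurable[OF fun_op_sq_integrable[OF op_add_PiE[OF ST] un]]
    have "sq_norm M (\<lambda>x. fun_op M (op_add M S T) (u (r (q n))) x - (v x + w x))
      = sq_norm M (\<lambda>x. (fun_op M S (u (r (q n))) x - v x) + (fun_op M T (u (r (q n))) x - w x))"
      using fun_op_op_add[OF ST un]
      by (intro sq_norm_cong_AE) (auto simp: algebra_simps)
    also have "\<dots> \<le> sq_norm M (\<lambda>x. fun_op M S (u (r (q n))) x - v x)
        + sq_norm M (\<lambda>x. fun_op M T (u (r (q n))) x - w x)"
      by (rule sq_norm_triangle[OF sq_integrable_diff[OF sqS v] sq_integrable_diff[OF sqT w]])
    finally show ?thesis .
  qed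
  have "(\<lambda>n. sq_norm M (\<lambda>x. fun_op M S (u (r (q n))) x - v x)) \<longlonglongrightarrow> 0"
    using LIMSEQ_subseq_LIMSEQ[OF lim q] by (simp add: comp_def)
  from tendsto_add_zero[OF this lim']
  have "(\<lambda>n. sq_norm M (\<lambda>x. fun_op M (op_add M S T) (u (r (q n))) x - (v x + w x))) \<longlonglongrightarrow> 0"
    by (rule Lim_null_comparison[rotated]) (simp add: bound)
  moreover have "strict_mono (\<lambda>n. r (q n))"
    using strict_mono_o[OF r q] by (simp add: comp_def)
  ultimately show "\<exists>r v. strict_mono (r :: nat \<Rightarrow> nat) \<and> v \<in> sq_integrable M \<and>
      (\<lambda>n. sq_norm M (\<lambda>x. fun_op M (op_add M S T) (u (r n)) x - v x)) \<longlonglongrightarrow> 0"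
    using sq_integrable_add[OF v w]
    by (intro exI[of _ "\<lambda>n. r (q n)"] exI[of _ "\<lambda>x. v x + w x"]) simp
qed

text \<open>An unbounded operator has images of norm at least \<open>n\<close> of vectors from the unit ball, and no
  subsequence of those converges.\<close>

lemma compact_operators_bounded:
  assumes "T \<in> compact_operators M"
  obtains C where "0 \<le> C" "\<And>u. u \<in> sq_integrable M \<Longrightarrow> sq_norm M (fun_op M T u) \<le> C * sq_norm M u"
proof (rule ccontr)
  assume "\<not> thesis"
  with that have unbounded: "\<exists>u\<in>sq_integrable M. \<not> sq_norm M (fun_op M T u) \<le> C * sq_norm M u"
    if "0 \<le> C" for C
    using that by blast
  note lin = compact_operators_L2_linear[OF assms]
  note T = L2_linear_PiE[OF lin]
  have normalized: "\<exists>u\<in>sq_integrable M. sq_norm M u \<le> 1 \<and> real n \<le> sq_norm M (fun_op M T u)" for n :: nat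
  proof -
    obtain u where u: "u \<in> sq_integrable M" "real n * sq_norm M u < sq_norm M (fun_op M T u)"
      using unbounded[of "real n"] by auto
    define c where "c = complex_of_real (real n / sq_norm M (fun_op M T u))"
    have pos: "0 < sq_norm M (fun_op M T u)"
      using u(2) by (smt (verit) mult_nonneg_nonneg of_nat_0_le_iff sq_norm_nonneg)
    have c: "cmod c = real n / sq_norm M (fun_op M T u)"
      by (simp add: c_def norm_divide)
    have "sq_norm M (fun_op M T (\<lambda>x. c * u x)) = sq_norm M (\<lambda>x. c * fun_op M T u x)"
      using fun_op_scale[OF lin u(1), of c] u(1)
      by (intro sq_norm_cong_AE) (auto intro!: sq_integrable_measurable sq_integrable_scale fun_op_sq_integrable T)
    also have "\<dots> = real n"
      using pos by (simp add: sq_norm_scale c)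
    finally have "real n \<le> sq_norm M (fun_op M T (\<lambda>x. c * u x))" by simp
    moreover have "sq_norm M (\<lambda>x. c * u x) \<le> 1"
      using u(2) pos by (simp add: sq_norm_scale c field_simps)
    ultimately show ?thesis
      using sq_integrable_scale[OF u(1), of c] by blast
  qed
  then obtain u where u: "\<And>n. u n \<in> sq_integrable M" "\<And>n. sq_norm M (u n) \<le> 1"
    "\<And>n. real n \<le> sq_norm M (fun_op M T (u n))"
    by metis
  obtain r v where r: "strict_mono (r :: nat \<Rightarrow> nat)" and v: "v \<in> sq_integrable M"
    and lim: "(\<lambda>n. sq_norm M (\<lambda>x. fun_op M T (u (r n)) x - v x)) \<longlonglongrightarrow> 0"
    by (rule compact_operators_subseq[OF assms u(1,2)])
  have "eventually (\<lambda>n. sq_norm M (\<lambda>x. fun_op M T (u (r n)) x - v x) < 1) sequentially"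
    using order_tendstoD(2)[OF lim, of 1] by simp
  moreover have "eventually (\<lambda>n. sq_norm M v + 1 < real n) sequentially"
    using filterlim_real_sequentially by (simp add: filterlim_at_top_dense)
  ultimately have "eventually (\<lambda>n. False) sequentially"
  proof eventually_elim
    fix n assume n: "sq_norm M (\<lambda>x. fun_op M T (u (r n)) x - v x) < 1" "sq_norm M v + 1 < real n"
    note sq = fun_op_sq_integrable[OF T u(1)[of "r n"]]
    have "sq_norm M (fun_op M T (u (r n))) \<le> sq_norm M (\<lambda>x. fun_op M T (u (r n)) x - v x) + sq_norm M v"
      using sq_norm_triangle[OF sq_integrable_diff[OF sq v] v] by simp
    moreover have "real n \<le> real (r n)"
      using seq_suble[OF r, of n] by simp
    ultimately show False
      using u(3)[of "r n"] n by linarith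
  qed
  then show False by simp
qed

section \<open>Integral operators and the closure of the multiplier graph\<close>

definition kernel_op :: "'a measure \<Rightarrow> ('a \<times> 'a \<Rightarrow> complex) \<Rightarrow> ('a \<Rightarrow> complex) \<Rightarrow> 'a \<Rightarrow> complex" where
  "kernel_op M k u y = (\<integral>x. k (x, y) * u x \<partial>M)"

text \<open>Closeness of \<^term>\<open>T\<close> to the integral operator with kernel \<^term>\<open>k\<close> is tested on functions, with
  a non-strict bound, so that errors add up and scale without reference to the supremum in the
  operator norm.\<close>

definition near_kernel :: "'a measure \<Rightarrow> real \<Rightarrow> 'a L2_op \<Rightarrow> ('a \<times> 'a \<Rightarrow> complex) \<Rightarrow> bool" where
  "near_kernel M e T k \<longleftrightarrow> (\<forall>u\<in>sq_integrable M.
     sq_norm M (\<lambda>y. fun_op M T u y - kernel_op M k u y) \<le> e * sq_norm M u)"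

context sigma_finite_measure
begin

text \<open>By Fubini almost every slice \<open>k(\<cdot>, y)\<close> is square integrable, and the Cauchy--Schwarz inequality
  on slices is the Hilbert--Schmidt estimate.\<close>

lemma
  assumes "k \<in> sq_integrable (M \<Otimes>\<^sub>M M)" "u \<in> sq_integrable M"
  shows AE_integrable_kernel: "AE y in M. integrable M (\<lambda>x. k (x, y) * u x)"
    and kernel_op_sq_integrable: "kernel_op M k u \<in> sq_integrable M"
proof -
  interpret P: pair_sigma_finite M M ..
  note k [measurable] = sq_integrableD(1)[OF assms(1)]
  note u [measurable] = sq_integrableD(1)[OF assms(2)]
  have int2: "integrable (M \<Otimes>\<^sub>M M) (\<lambda>(x, y). (cmod (k (x, y)))\<^sup>2)"
    using sq_integrableD(2)[OF assms(1)] by (simp add: case_prod_unfold)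
  have slice: "AE y in M. (\<lambda>x. k (x, y)) \<in> sq_integrable M"
    using P.AE_integrable_snd[OF int2] AE_space
    by eventually_elim (simp add: sq_integrable_def)
  then show "AE y in M. integrable M (\<lambda>x. k (x, y) * u x)"
    by eventually_elim (rule sq_integrable_product[OF _ assms(2)])
  have meas [measurable]: "kernel_op M k u \<in> borel_measurable M"
    unfolding kernel_op_def by measurable
  let ?h = "\<lambda>y. (\<integral>x. (cmod (k (x, y)))\<^sup>2 \<partial>M) * (sq_norm M u)\<^sup>2"
  have int: "integrable M ?h"
    using P.integrable_snd[OF int2] by simp
  have "AE y in M. norm ((cmod (kernel_op M k u y))\<^sup>2) \<le> norm (?h y)"
    using slice
  proof eventually_elim
    fix y assume y: "(\<lambda>x. k (x, y)) \<in> sq_integrable M"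
    have "cmod (kernel_op M k u y) \<le> (\<integral>x. cmod (k (x, y) * u x) \<partial>M)"
      unfolding kernel_op_def by (rule integral_norm_bound)
    also have "\<dots> \<le> sq_norm M (\<lambda>x. k (x, y)) * sq_norm M u"
      using Cauchy_Schwarz_sq_norm[OF y assms(2)] by (simp add: norm_mult)
    finally have "(cmod (kernel_op M k u y))\<^sup>2 \<le> (sq_norm M (\<lambda>x. k (x, y)) * sq_norm M u)\<^sup>2"
      by (simp add: power_mono)
    then show "norm ((cmod (kernel_op M k u y))\<^sup>2) \<le> norm (?h y)"
      by (simp add: power_mult_distrib sq_norm_power2 abs_mult)
  qed
  then have "integrable M (\<lambda>y. (cmod (kernel_op M k u y))\<^sup>2)"
    by (rule Bochner_Integration.integrable_bound[OF int, rotated]) simp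
  then show "kernel_op M k u \<in> sq_integrable M"
    by (simp add: sq_integrable_def)
qed

lemma kernel_op_cong_AE:
  assumes "k \<in> borel_measurable (M \<Otimes>\<^sub>M M)" "u \<in> borel_measurable M" "v \<in> borel_measurable M"
    and "AE x in M. u x = v x" "y \<in> space M"
  shows "kernel_op M k u y = kernel_op M k v y"
proof -
  note [measurable] = assms(1,2,3,5)
  have "(\<lambda>x. k (x, y)) \<in> borel_measurable M"
    by measurable
  then show ?thesis
    unfolding kernel_op_def using assms by (intro integral_cong_AE) auto
qed

lemma
  assumes "k \<in> sq_integrable (M \<Otimes>\<^sub>M M)"
  shows integral_op_PiE: "integral_op M k \<in> L2 M \<rightarrow>\<^sub>E L2 M"
    and fun_op_integral_op: "u \<in> sq_integrable M \<Longrightarrow>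
      AE y in M. fun_op M (integral_op M k) u y = kernel_op M k u y"
proof -
  have op: "integral_op M k = (\<lambda>a\<in>L2 M. L2_class M (kernel_op M k (L2_rep a)))"
    by (simp add: integral_op_def kernel_op_def[abs_def])
  show "integral_op M k \<in> L2 M \<rightarrow>\<^sub>E L2 M"
    using assms by (simp add: op L2_class_in_L2 kernel_op_sq_integrable L2_rep_in_sq_integrable)
  assume u: "u \<in> sq_integrable M"
  note rep = L2_rep_class[OF u]
  have "L2_class M (kernel_op M k (L2_rep (L2_class M u))) = L2_class M (kernel_op M k u)"
  proof (rule L2_class_cong)
    show "AE y in M. kernel_op M k (L2_rep (L2_class M u)) y = kernel_op M k u y"
      using rep u assms
      by (intro AE_I2 kernel_op_cong_AE[OF _ _ _ rep(2)]) (auto intro: sq_integrable_measurable)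
  qed (auto intro!: sq_integrable_measurable kernel_op_sq_integrable assms u rep)
  then have "integral_op M k (L2_class M u) = L2_class M (kernel_op M k u)"
    using u by (simp add: op L2_class_in_L2)
  then show "AE y in M. fun_op M (integral_op M k) u y = kernel_op M k u y"
    by (rule fun_op_AE_eq) (rule kernel_op_sq_integrable[OF assms u])
qed

lemma L2_linear_integral_op:
  assumes "k \<in> sq_integrable (M \<Otimes>\<^sub>M M)"
  shows "L2_linear M (integral_op M k)"
proof (rule L2_linearI)
  show "integral_op M k \<in> L2 M \<rightarrow>\<^sub>E L2 M"
    by (rule integral_op_PiE[OF assms])
  note k = fun_op_integral_op[OF assms]
  fix u v :: "'a \<Rightarrow> complex" and c
  assume u: "u \<in> sq_integrable M"
  show "AE y in M. fun_op M (integral_op M k) (\<lambda>x. c * u x) y = c * fun_op M (integral_op M k) u y"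
    using k[OF sq_integrable_scale[OF u, of c]] k[OF u]
    by eventually_elim (simp add: kernel_op_def mult.left_commute)
  assume v: "v \<in> sq_integrable M"
  show "AE y in M. fun_op M (integral_op M k) (\<lambda>x. u x + v x) y
      = fun_op M (integral_op M k) u y + fun_op M (integral_op M k) v y"
    using k[OF sq_integrable_add[OF u v]] k[OF u] k[OF v]
      AE_integrable_kernel[OF assms u] AE_integrable_kernel[OF assms v]
    by eventually_elim (simp add: kernel_op_def algebra_simps)
qed

lemma sq_norm_integral_op_diff:
  assumes "T \<in> L2 M \<rightarrow>\<^sub>E L2 M" "k \<in> sq_integrable (M \<Otimes>\<^sub>M M)" "u \<in> sq_integrable M"
  shows "sq_norm M (\<lambda>y. fun_op M T u y - fun_op M (integral_op M k) u y)
    = sq_norm M (\<lambda>y. fun_op M T u y - kernel_op M k u y)"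
proof (rule sq_norm_cong_AE)
  show "AE y in M. fun_op M T u y - fun_op M (integral_op M k) u y
      = fun_op M T u y - kernel_op M k u y"
    using fun_op_integral_op[OF assms(2,3)] by eventually_elim simp
qed (use assms integral_op_PiE[OF assms(2)] in
  \<open>auto intro!: sq_integrable_measurable sq_integrable_diff fun_op_sq_integrable kernel_op_sq_integrable\<close>)

lemma near_kernelI:
  assumes "L2_linear M T" "k \<in> sq_integrable (M \<Otimes>\<^sub>M M)" "op_dist M T (integral_op M k) < ennreal e"
  shows "near_kernel M e T k"
  using op_dist_lessD[OF assms(1) L2_linear_integral_op[OF assms(2)] assms(3)]
    sq_norm_integral_op_diff[OF L2_linear_PiE[OF assms(1)] assms(2)]
  by (simp add: near_kernel_def)

lemma op_dist_integral_op_le: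
  assumes "T \<in> L2 M \<rightarrow>\<^sub>E L2 M" "k \<in> sq_integrable (M \<Otimes>\<^sub>M M)" "0 \<le> e" "near_kernel M e T k"
  shows "op_dist M T (integral_op M k) \<le> ennreal e"
  using assms(4) sq_norm_integral_op_diff[OF assms(1,2)]
  by (intro op_dist_leI assms integral_op_PiE) (simp add: near_kernel_def)

text \<open>This characterisation removes the operator norm and the integral operators on classes from the
  definition of the closed graph. Halving \<^term>\<open>e\<close> turns the non-strict bound into a strict one.\<close>

lemma norm_closure_mult_graph_iff:
  "(S, T) \<in> norm_closure M (mult_graph M \<phi>) \<longleftrightarrow>
    S \<in> compact_operators M \<and> T \<in> compact_operators M \<and>
    (\<forall>e>0. \<exists>k\<in>mult_domain M \<phi>. near_kernel M e S k \<and> near_kernel M e T (\<lambda>z. \<phi> z * k z))"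
    (is "_ \<longleftrightarrow> ?S \<and> ?T \<and> ?near")
proof (cases "?S \<and> ?T")
  case True
  then have lin: "L2_linear M S" "L2_linear M T"
    by (simp_all add: compact_operators_L2_linear)
  note ST = lin[THEN L2_linear_PiE]
  have sq: "k \<in> sq_integrable (M \<Otimes>\<^sub>M M)" "(\<lambda>z. \<phi> z * k z) \<in> sq_integrable (M \<Otimes>\<^sub>M M)"
    if "k \<in> mult_domain M \<phi>" for k
    using that by (auto simp: mult_domain_def)
  have closure: "(S, T) \<in> norm_closure M (mult_graph M \<phi>) \<longleftrightarrow>
    (\<forall>e>0. \<exists>k\<in>mult_domain M \<phi>. op_dist M S (integral_op M k) < ennreal e \<and>
      op_dist M T (integral_op M (\<lambda>z. \<phi> z * k z)) < ennreal e)"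
    using True unfolding norm_closure_def mult_graph_def by (simp add: Bex_def split_beta) blast
  have "(S, T) \<in> norm_closure M (mult_graph M \<phi>) \<longleftrightarrow> ?near"
  proof
    assume "(S, T) \<in> norm_closure M (mult_graph M \<phi>)"
    then show ?near
      unfolding closure using near_kernelI[OF lin(1) sq(1)] near_kernelI[OF lin(2) sq(2)] by blast
  next
    assume near: ?near
    show "(S, T) \<in> norm_closure M (mult_graph M \<phi>)"
      unfolding closure
    proof (intro allI impI)
      fix e :: real assume e: "0 < e"
      then obtain k where k: "k \<in> mult_domain M \<phi>" "near_kernel M (e / 2) S k"
        "near_kernel M (e / 2) T (\<lambda>z. \<phi> z * k z)"
        using near half_gt_zero by blast
      have "ennreal (e / 2) < ennreal e"
        using e by (simp add: ennreal_less_iff)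
      then show "\<exists>k\<in>mult_domain M \<phi>. op_dist M S (integral_op M k) < ennreal e \<and>
          op_dist M T (integral_op M (\<lambda>z. \<phi> z * k z)) < ennreal e"
        using op_dist_integral_op_le[OF ST(1) sq(1)[OF k(1)] _ k(2)]
          op_dist_integral_op_le[OF ST(2) sq(2)[OF k(1)] _ k(3)] e k(1)
        by (intro bexI[OF _ k(1)]) auto
    qed
  qed
  then show ?thesis using True by simp
qed (auto simp: norm_closure_def)

lemma near_kernel_op_scale:
  assumes "T \<in> L2 M \<rightarrow>\<^sub>E L2 M" "k \<in> sq_integrable (M \<Otimes>\<^sub>M M)" "near_kernel M e T k"
  shows "near_kernel M (cmod c * e) (op_scale M c T) (\<lambda>z. c * k z)"
  unfolding near_kernel_def
proof
  fix u assume u: "u \<in> sq_integrable M"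
  note [measurable] = fun_op_sq_integrable[OF assms(1) u, THEN sq_integrable_measurable]
    fun_op_sq_integrable[OF op_scale_PiE[OF assms(1)] u, THEN sq_integrable_measurable]
    kernel_op_sq_integrable[OF assms(2) u, THEN sq_integrable_measurable]
    kernel_op_sq_integrable[OF sq_integrable_scale[OF assms(2)] u, THEN sq_integrable_measurable]
  have "sq_norm M (\<lambda>y. fun_op M (op_scale M c T) u y - kernel_op M (\<lambda>z. c * k z) u y)
      = sq_norm M (\<lambda>y. c * (fun_op M T u y - kernel_op M k u y))"
  proof (rule sq_norm_cong_AE)
    show "AE y in M. fun_op M (op_scale M c T) u y - kernel_op M (\<lambda>z. c * k z) u y
        = c * (fun_op M T u y - kernel_op M k u y)"
      using fun_op_op_scale[OF assms(1) u, of c]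
      by eventually_elim (simp add: kernel_op_def mult.assoc algebra_simps)
  qed measurable
  also have "\<dots> \<le> cmod c * (e * sq_norm M u)"
    using assms(3) u by (simp add: sq_norm_scale near_kernel_def mult_left_mono)
  finally show "sq_norm M (\<lambda>y. fun_op M (op_scale M c T) u y - kernel_op M (\<lambda>z. c * k z) u y)
      \<le> cmod c * e * sq_norm M u" by (simp add: mult.assoc)
qed

lemma near_kernel_op_add:
  assumes "S \<in> L2 M \<rightarrow>\<^sub>E L2 M" "T \<in> L2 M \<rightarrow>\<^sub>E L2 M"
    and "k \<in> sq_integrable (M \<Otimes>\<^sub>M M)" "l \<in> sq_integrable (M \<Otimes>\<^sub>M M)"
    and "near_kernel M d S k" "near_kernel M e T l"
  shows "near_kernel M (d + e) (op_add M S T) (\<lambda>z. k z + l z)"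
  unfolding near_kernel_def
proof
  fix u assume u: "u \<in> sq_integrable M"
  note sq = fun_op_sq_integrable[OF assms(1) u] fun_op_sq_integrable[OF assms(2) u]
    kernel_op_sq_integrable[OF assms(3) u] kernel_op_sq_integrable[OF assms(4) u]
    kernel_op_sq_integrable[OF sq_integrable_add[OF assms(3,4)] u]
    fun_op_sq_integrable[OF op_add_PiE[OF assms(1,2)] u]
  note [measurable] = sq[THEN sq_integrable_measurable]
  have "sq_norm M (\<lambda>y. fun_op M (op_add M S T) u y - kernel_op M (\<lambda>z. k z + l z) u y)
      = sq_norm M (\<lambda>y. (fun_op M S u y - kernel_op M k u y) + (fun_op M T u y - kernel_op M l u y))"
  proof (rule sq_norm_cong_AE)
    show "AE y in M. fun_op M (op_add M S T) u y - kernel_op M (\<lambda>z. k z + l z) u y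
        = (fun_op M S u y - kernel_op M k u y) + (fun_op M T u y - kernel_op M l u y)"
      using fun_op_op_add[OF assms(1,2) u] AE_integrable_kernel[OF assms(3) u]
        AE_integrable_kernel[OF assms(4) u]
      by eventually_elim (simp add: kernel_op_def algebra_simps)
  qed measurable
  also have "\<dots> \<le> sq_norm M (\<lambda>y. fun_op M S u y - kernel_op M k u y)
      + sq_norm M (\<lambda>y. fun_op M T u y - kernel_op M l u y)"
    by (rule sq_norm_triangle[OF sq_integrable_diff[OF sq(1,3)] sq_integrable_diff[OF sq(2,4)]])
  also have "\<dots> \<le> d * sq_norm M u + e * sq_norm M u"
    using assms(5,6) u by (auto simp: near_kernel_def intro!: add_mono)
  finally show "sq_norm M (\<lambda>y. fun_op M (op_add M S T) u y - kernel_op M (\<lambda>z. k z + l z) u y)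
      \<le> (d + e) * sq_norm M u" by (simp add: distrib_right)
qed

lemma near_kernel_mono: "near_kernel M d T k \<Longrightarrow> d \<le> e \<Longrightarrow> near_kernel M e T k"
  unfolding near_kernel_def by (meson mult_right_mono order_trans sq_norm_nonneg)

lemma mult_domain_add:
  assumes "k \<in> mult_domain M \<phi>" "l \<in> mult_domain M \<phi>"
  shows "(\<lambda>z. k z + l z) \<in> mult_domain M \<phi>"
  using assms sq_integrable_add[of k "M \<Otimes>\<^sub>M M" l]
    sq_integrable_add[of "\<lambda>z. \<phi> z * k z" "M \<Otimes>\<^sub>M M" "\<lambda>z. \<phi> z * l z"]
  by (simp add: mult_domain_def distrib_left)

lemma mult_domain_scale:
  assumes "k \<in> mult_domain M \<phi>"
  shows "(\<lambda>z. c * k z) \<in> mult_domain M \<phi>"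
  using assms sq_integrable_scale[of k "M \<Otimes>\<^sub>M M" c]
    sq_integrable_scale[of "\<lambda>z. \<phi> z * k z" "M \<Otimes>\<^sub>M M" c]
  by (simp add: mult_domain_def mult.left_commute)

lemma norm_closure_mult_graph_add:
  assumes "(S, T) \<in> norm_closure M (mult_graph M \<phi>)" "(S', T') \<in> norm_closure M (mult_graph M \<phi>)"
  shows "(op_add M S S', op_add M T T') \<in> norm_closure M (mult_graph M \<phi>)"
  unfolding norm_closure_mult_graph_iff
proof (intro conjI allI impI)
  have comp: "S \<in> compact_operators M" "T \<in> compact_operators M"
    "S' \<in> compact_operators M" "T' \<in> compact_operators M"
    using assms by (auto simp: norm_closure_def)
  then show "op_add M S S' \<in> compact_operators M" "op_add M T T' \<in> compact_operators M"
    by (simp_all add: compact_operators_op_add)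
  note PiE = comp[THEN compact_operators_L2_linear, THEN L2_linear_PiE]
  fix e :: real assume "0 < e"
  then have "0 < e / 2" by simp
  then obtain k l where k: "k \<in> mult_domain M \<phi>" "near_kernel M (e / 2) S k"
      "near_kernel M (e / 2) T (\<lambda>z. \<phi> z * k z)"
    and l: "l \<in> mult_domain M \<phi>" "near_kernel M (e / 2) S' l"
      "near_kernel M (e / 2) T' (\<lambda>z. \<phi> z * l z)"
    using assms unfolding norm_closure_mult_graph_iff by meson
  have sq: "k \<in> sq_integrable (M \<Otimes>\<^sub>M M)" "(\<lambda>z. \<phi> z * k z) \<in> sq_integrable (M \<Otimes>\<^sub>M M)"
    "l \<in> sq_integrable (M \<Otimes>\<^sub>M M)" "(\<lambda>z. \<phi> z * l z) \<in> sq_integrable (M \<Otimes>\<^sub>M M)"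
    using k(1) l(1) by (auto simp: mult_domain_def)
  have "near_kernel M e (op_add M S S') (\<lambda>z. k z + l z)"
    using near_kernel_op_add[OF PiE(1,3) sq(1,3) k(2) l(2)] by simp
  moreover have "near_kernel M e (op_add M T T') (\<lambda>z. \<phi> z * (k z + l z))"
    using near_kernel_op_add[OF PiE(2,4) sq(2,4) k(3) l(3)] by (simp add: distrib_left)
  ultimately show "\<exists>k\<in>mult_domain M \<phi>. near_kernel M e (op_add M S S') k \<and>
      near_kernel M e (op_add M T T') (\<lambda>z. \<phi> z * k z)"
    using mult_domain_add[OF k(1) l(1)] by blast
qed

lemma norm_closure_mult_graph_scale:
  assumes "(S, T) \<in> norm_closure M (mult_graph M \<phi>)"
  shows "(op_scale M c S, op_scale M c T) \<in> norm_closure M (mult_graph M \<phi>)"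
  unfolding norm_closure_mult_graph_iff
proof (intro conjI allI impI)
  have comp: "S \<in> compact_operators M" "T \<in> compact_operators M"
    using assms by (auto simp: norm_closure_def)
  then show "op_scale M c S \<in> compact_operators M" "op_scale M c T \<in> compact_operators M"
    by (simp_all add: compact_operators_op_scale)
  note PiE = comp[THEN compact_operators_L2_linear, THEN L2_linear_PiE]
  fix e :: real assume e: "0 < e"
  define d where "d = e / (cmod c + 1)"
  have "0 < cmod c + 1"
    by (smt (verit) norm_ge_zero)
  then have d: "0 < d" "cmod c * d \<le> e"
    using e by (simp_all add: d_def field_simps)
  from d(1) obtain k where k: "k \<in> mult_domain M \<phi>" "near_kernel M d S k"
      "near_kernel M d T (\<lambda>z. \<phi> z * k z)"
    using assms unfolding norm_closure_mult_graph_iff by meson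
  have sq: "k \<in> sq_integrable (M \<Otimes>\<^sub>M M)" "(\<lambda>z. \<phi> z * k z) \<in> sq_integrable (M \<Otimes>\<^sub>M M)"
    using k(1) by (auto simp: mult_domain_def)
  have "near_kernel M e (op_scale M c S) (\<lambda>z. c * k z)"
    using near_kernel_mono[OF near_kernel_op_scale[OF PiE(1) sq(1) k(2)] d(2)] .
  moreover have "near_kernel M e (op_scale M c T) (\<lambda>z. \<phi> z * (c * k z))"
    using near_kernel_mono[OF near_kernel_op_scale[OF PiE(2) sq(2) k(3)] d(2)]
    by (simp add: mult.left_commute)
  ultimately show "\<exists>k\<in>mult_domain M \<phi>. near_kernel M e (op_scale M c S) k \<and>
      near_kernel M e (op_scale M c T) (\<lambda>z. \<phi> z * k z)"
    using mult_domain_scale[OF k(1)] by blast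
qed

lemma norm_closure_mult_graph_nonempty: "norm_closure M (mult_graph M \<phi>) \<noteq> {}"
proof -
  let ?Z = "integral_op M (\<lambda>z. 0)"
  have zero: "(\<lambda>z. 0) \<in> sq_integrable (M \<Otimes>\<^sub>M M)" by simp
  note Z = integral_op_PiE[OF zero]
  have near: "near_kernel M e ?Z (\<lambda>z. 0)" if "0 < e" for e
    using sq_norm_integral_op_diff[OF Z zero, symmetric] that by (simp add: near_kernel_def)
  have "?Z \<in> compact_operators M"
    unfolding compact_operators_iff
  proof (intro conjI allI impI)
    fix u :: "nat \<Rightarrow> _" assume u: "\<forall>n. u n \<in> sq_integrable M"
    have "sq_norm M (\<lambda>y. fun_op M ?Z (u n) y - 0) = 0" for n
      using sq_norm_integral_op_diff[OF Z zero, of "u n"] u by (simp add: kernel_op_def)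
    then show "\<exists>r v. strict_mono (r :: nat \<Rightarrow> nat) \<and> v \<in> sq_integrable M \<and>
        (\<lambda>n. sq_norm M (\<lambda>x. fun_op M ?Z (u (r n)) x - v x)) \<longlonglongrightarrow> 0"
      by (intro exI[of _ id] exI[of _ "\<lambda>x. 0"]) (simp add: strict_mono_def)
  qed (rule L2_linear_integral_op[OF zero])
  then have "(?Z, ?Z) \<in> norm_closure M (mult_graph M \<phi>)"
    unfolding norm_closure_mult_graph_iff using near
    by (intro conjI allI impI bexI[of _ "\<lambda>z. 0"]) (simp_all add: mult_domain_def)
  then show ?thesis by blast
qed

end

section \<open>Compact operators commuting with a multiplication\<close>

lemma sq_norm_disjoint_supports:
  assumes "u \<in> sq_integrable M" "v \<in> sq_integrable M" "AE x in M. u x = 0 \<or> v x = 0"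
  shows "(sq_norm M (\<lambda>x. u x + v x))\<^sup>2 = (sq_norm M u)\<^sup>2 + (sq_norm M v)\<^sup>2"
proof -
  note [measurable] = sq_integrableD(1)[OF assms(1)] sq_integrableD(1)[OF assms(2)]
  have "(\<integral>x. (cmod (u x + v x))\<^sup>2 \<partial>M) = (\<integral>x. (cmod (u x))\<^sup>2 + (cmod (v x))\<^sup>2 \<partial>M)"
    using assms(3) by (intro integral_cong_AE) auto
  then show ?thesis
    using sq_integrableD(2)[OF assms(1)] sq_integrableD(2)[OF assms(2)] by (simp add: sq_norm_power2)
qed

text \<open>Here \<^term>\<open>R\<close> is any map on functions that behaves almost everywhere like a compact linear operator.
  A map rather than an operator on classes is convenient because the instance used below is a
  compression, which is a simple formula on functions. The last assumption plays the part of
  null level sets of \<^term>\<open>g\<close>, in the form that a compression to a set \<open>K\<close> satisfies when only the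
  parts of the level sets inside \<open>K\<close> are null.\<close>

locale compact_commuting_op =
  fixes M :: "'a measure" and R :: "('a \<Rightarrow> complex) \<Rightarrow> 'a \<Rightarrow> complex"
    and g :: "'a \<Rightarrow> real" and B C :: real
  assumes R_sq: "u \<in> sq_integrable M \<Longrightarrow> R u \<in> sq_integrable M"
    and R_add: "u \<in> sq_integrable M \<Longrightarrow> v \<in> sq_integrable M \<Longrightarrow>
      AE y in M. R (\<lambda>x. u x + v x) y = R u y + R v y"
    and R_scale: "u \<in> sq_integrable M \<Longrightarrow> AE y in M. R (\<lambda>x. c * u x) y = c * R u y"
    and R_bounded: "u \<in> sq_integrable M \<Longrightarrow> sq_norm M (R u) \<le> C * sq_norm M u" and C_nonneg: "0 \<le> C"
    and R_compact: "(\<And>m. s m \<in> sq_integrable M) \<Longrightarrow> (\<And>m. sq_norm M (s m) \<le> 1) \<Longrightarrow>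
      \<exists>r v. strict_mono (r :: nat \<Rightarrow> nat) \<and> v \<in> sq_integrable M \<and>
        (\<lambda>m. sq_norm M (\<lambda>y. R (s (r m)) y - v y)) \<longlonglongrightarrow> 0"
    and g_measurable [measurable]: "g \<in> borel_measurable M" and g_bounded: "\<bar>g x\<bar> \<le> B"
    and R_commute: "u \<in> sq_integrable M \<Longrightarrow>
      AE y in M. R (\<lambda>x. complex_of_real (g x) * u x) y = complex_of_real (g y) * R u y"
    and R_level: "u \<in> sq_integrable M \<Longrightarrow> AE y in M. g y = t \<longrightarrow> R u y = 0"
begin

lemma sq_shift:
  assumes "u \<in> sq_integrable M"
  shows "(\<lambda>x. complex_of_real (g x - t) * u x) \<in> sq_integrable M"
proof (rule sq_integrable_bounded_mult[OF assms])
  show "cmod (complex_of_real (g x - t)) \<le> B + \<bar>t\<bar>" for x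
    using g_bounded[of x] unfolding norm_of_real by linarith
qed measurable

lemma sq_shift_power:
  assumes "u \<in> sq_integrable M"
  shows "(\<lambda>x. complex_of_real (g x - t) ^ m * u x) \<in> sq_integrable M"
proof (induction m)
  case (Suc m)
  then show ?case
    using sq_shift[OF Suc, of t] by (simp add: mult.assoc)
qed (use assms in simp)

lemma R_shift:
  assumes "u \<in> sq_integrable M"
  shows "AE y in M. R (\<lambda>x. complex_of_real (g x - t) * u x) y = complex_of_real (g y - t) * R u y"
proof -
  have gu: "(\<lambda>x. complex_of_real (g x) * u x) \<in> sq_integrable M"
    using sq_shift[OF assms, of 0] by simp
  have eq: "(\<lambda>x. complex_of_real (g x - t) * u x)
      = (\<lambda>x. complex_of_real (g x) * u x + (- complex_of_real t) * u x)"
    by (simp add: algebra_simps)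
  show ?thesis
    unfolding eq
    using R_add[OF gu sq_integrable_scale[OF assms, of "- complex_of_real t"]] R_commute[OF assms]
      R_scale[OF assms, of "- complex_of_real t"]
    by eventually_elim (simp add: algebra_simps)
qed

lemma R_shift_power:
  assumes "u \<in> sq_integrable M"
  shows "AE y in M. R (\<lambda>x. complex_of_real (g x - t) ^ m * u x) y = complex_of_real (g y - t) ^ m * R u y"
proof (induction m)
  case (Suc m)
  have eq: "(\<lambda>x. complex_of_real (g x - t) ^ Suc m * u x)
      = (\<lambda>x. complex_of_real (g x - t) * (complex_of_real (g x - t) ^ m * u x))"
    by (simp add: mult.assoc)
  show ?case
    unfolding eq using R_shift[OF sq_shift_power[OF assms, of t m], of t] Suc
    by eventually_elim simp
qed simp

lemma zero_of_geometric_bound: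
  assumes "w \<in> sq_integrable M" "0 \<le> r" "r < s" "\<And>m. s ^ m * sq_norm M w \<le> D * r ^ m"
  shows "AE y in M. w y = 0"
proof (rule AE_zero_of_sq_norm_zero[OF assms(1)])
  have "0 < s" using assms(2,3) by linarith
  have "sq_norm M w \<le> D * (r / s) ^ m" for m
    using assms(4)[of m] \<open>0 < s\<close> by (simp add: power_divide field_simps)
  moreover have "(\<lambda>m. D * (r / s) ^ m) \<longlonglongrightarrow> D * 0"
    using assms(2,3) by (intro tendsto_mult tendsto_const LIMSEQ_realpow_zero) simp_all
  ultimately have "sq_norm M w \<le> D * 0"
    by (intro LIMSEQ_le_const) auto
  then show "sq_norm M w = 0"
    using sq_norm_nonneg[of M w] by simp
qed

text \<open>Where \<open>|g - t| \<ge> s > r\<close>, the function \<open>R u\<close> is at most \<open>s\<^sup>-\<^sup>m |(g - t)\<^sup>m R u|\<close>, and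
  \<open>(g - t)\<^sup>m R u = R ((g - t)\<^sup>m u)\<close> has norm at most a constant times \<open>r\<^sup>m\<close>, because \<open>|g - t| \<le> r\<close> on the
  support of \<open>u\<close>. Letting \<open>m\<close> grow shows that \<open>R u\<close> vanishes there.\<close>

lemma R_support_ball:
  assumes u: "u \<in> sq_integrable M" and supp: "\<And>x. u x \<noteq> 0 \<Longrightarrow> \<bar>g x - t\<bar> \<le> r" and "0 \<le> r"
  shows "AE y in M. R u y \<noteq> 0 \<longrightarrow> \<bar>g y - t\<bar> \<le> r"
proof -
  note [measurable] = R_sq[OF u, THEN sq_integrable_measurable] u[THEN sq_integrable_measurable]
  have far: "AE y in M. s \<le> \<bar>g y - t\<bar> \<longrightarrow> R u y = 0" if s: "r < s" for s
  proof -
    define w where "w y = indicator {y. s \<le> \<bar>g y - t\<bar>} y * R u y" for y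
    have w_meas [measurable]: "w \<in> borel_measurable M"
      unfolding w_def by measurable
    have w_sq: "w \<in> sq_integrable M"
      by (rule sq_integrable_dominated(1)[OF R_sq[OF u] w_meas, of 1])
        (auto simp: w_def indicator_def)
    have "s ^ m * sq_norm M w \<le> (C * sq_norm M u) * r ^ m" for m
    proof -
      let ?p = "\<lambda>x. complex_of_real (g x - t) ^ m * u x"
      have "AE y in M. cmod (complex_of_real (s ^ m) * w y) \<le> 1 * cmod (R ?p y)"
        using R_shift_power[OF u, of t m]
      proof eventually_elim
        fix y assume "R ?p y = complex_of_real (g y - t) ^ m * R u y"
        moreover have "s ^ m \<le> \<bar>g y - t\<bar> ^ m" if "s \<le> \<bar>g y - t\<bar>"
          using that s assms(3) by (intro power_mono) auto
        ultimately show "cmod (complex_of_real (s ^ m) * w y) \<le> 1 * cmod (R ?p y)"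
          using s assms(3)
          by (auto simp: w_def indicator_def norm_mult norm_power mult_right_mono simp del: of_real_diff of_real_power)
      qed
      then have "sq_norm M (\<lambda>y. complex_of_real (s ^ m) * w y) \<le> 1 * sq_norm M (R ?p)"
        by (intro sq_integrable_dominated(2) R_sq sq_shift_power u) measurable
      then have "s ^ m * sq_norm M w \<le> sq_norm M (R ?p)"
        using s assms(3) by (simp add: sq_norm_scale del: of_real_power)
      also have "\<dots> \<le> C * sq_norm M ?p"
        by (rule R_bounded[OF sq_shift_power[OF u]])
      also have "\<dots> \<le> C * (r ^ m * sq_norm M u)"
      proof (intro mult_left_mono C_nonneg)
        show "sq_norm M ?p \<le> r ^ m * sq_norm M u"
        proof (rule sq_integrable_dominated(2)[OF u])
          show "AE x in M. cmod (?p x) \<le> r ^ m * cmod (u x)"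
          proof (rule AE_I2)
            fix x
            show "cmod (?p x) \<le> r ^ m * cmod (u x)"
            proof (cases "u x = 0")
              case False
              then have "\<bar>g x - t\<bar> ^ m \<le> r ^ m"
                using supp by (intro power_mono) auto
              then show ?thesis
                by (simp add: norm_mult norm_power mult_right_mono del: of_real_diff)
            qed simp
          qed
        qed (use assms(3) in auto)
      qed
      finally show ?thesis
        by (simp add: mult_ac)
    qed
    from zero_of_geometric_bound[OF w_sq assms(3) s this]
    show ?thesis by eventually_elim (auto simp: w_def indicator_def)
  qed
  have "AE y in M. \<forall>j::nat. r + 1 / real (Suc j) \<le> \<bar>g y - t\<bar> \<longrightarrow> R u y = 0"
    by (subst AE_all_countable) (auto intro: far)
  then show ?thesis
  proof eventually_elim
    fix y assume y: "\<forall>j::nat. r + 1 / real (Suc j) \<le> \<bar>g y - t\<bar> \<longrightarrow> R u y = 0"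
    show "R u y \<noteq> 0 \<longrightarrow> \<bar>g y - t\<bar> \<le> r"
    proof (rule impI, rule ccontr)
      assume "R u y \<noteq> 0" "\<not> \<bar>g y - t\<bar> \<le> r"
      then obtain j :: nat where "1 / real (Suc j) < \<bar>g y - t\<bar> - r"
        using nat_approx_posE[of "\<bar>g y - t\<bar> - r"] by auto
      then show False
        using y \<open>R u y \<noteq> 0\<close> by (metis add.commute le_diff_eq less_imp_le)
    qed
  qed
qed

lemma R_support:
  assumes "u \<in> sq_integrable M" "\<And>x. u x \<noteq> 0 \<Longrightarrow> a \<le> g x \<and> g x \<le> b" "a \<le> b"
  shows "AE y in M. R u y \<noteq> 0 \<longrightarrow> a \<le> g y \<and> g y \<le> b"
proof -
  have ball: "\<bar>z - (a + b) / 2\<bar> \<le> (b - a) / 2 \<longleftrightarrow> a \<le> z \<and> z \<le> b" for z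
    by (auto simp: abs_le_iff field_simps)
  show ?thesis
    using R_support_ball[OF assms(1), of "(a + b) / 2" "(b - a) / 2"] assms(2,3)
    unfolding ball by auto
qed

text \<open>\<open>bound_on e a b\<close> means that \<^term>\<open>R\<close> has norm at most \<^term>\<open>e\<close> on the spectral subspace of
  multiplication by \<^term>\<open>g\<close> that belongs to the interval from \<^term>\<open>a\<close> to \<^term>\<open>b\<close>.\<close>

definition bound_on :: "real \<Rightarrow> real \<Rightarrow> real \<Rightarrow> bool" where
  "bound_on e a b \<longleftrightarrow> (\<forall>u\<in>sq_integrable M. (\<forall>x. u x \<noteq> 0 \<longrightarrow> a \<le> g x \<and> g x \<le> b) \<longrightarrow>
     sq_norm M (R u) \<le> e * sq_norm M u)"

text \<open>The two halves of \<^term>\<open>u\<close> have disjoint supports, and so have their images: by \<open>R_support\<close> these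
  can meet only where \<open>g = b\<close>, and there both vanish. So the squared norms add up on both sides.\<close>

lemma bound_on_join:
  assumes "bound_on e a b" "bound_on e b c" "a \<le> b" "b \<le> c" "0 \<le> e"
  shows "bound_on e a c"
  unfolding bound_on_def
proof (intro ballI impI)
  fix u assume u: "u \<in> sq_integrable M" and supp: "\<forall>x. u x \<noteq> 0 \<longrightarrow> a \<le> g x \<and> g x \<le> c"
  note [measurable] = u[THEN sq_integrable_measurable]
  define v where "v x = (if g x \<le> b then u x else 0)" for x
  define w where "w x = (if g x \<le> b then 0 else u x)" for x
  have [measurable]: "v \<in> borel_measurable M" "w \<in> borel_measurable M"
    unfolding v_def w_def by measurable
  have v: "v \<in> sq_integrable M"
    by (rule sq_integrable_dominated(1)[OF u, of _ 1]) (auto simp: v_def)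
  have w: "w \<in> sq_integrable M"
    by (rule sq_integrable_dominated(1)[OF u, of _ 1]) (auto simp: w_def)
  have split: "u = (\<lambda>x. v x + w x)"
    by (auto simp: v_def w_def)
  note Rv = R_sq[OF v] and Rw = R_sq[OF w]
  note [measurable] = Rv[THEN sq_integrable_measurable] Rw[THEN sq_integrable_measurable]
    R_sq[OF u, THEN sq_integrable_measurable]
  have v_supp: "\<forall>x. v x \<noteq> 0 \<longrightarrow> a \<le> g x \<and> g x \<le> b" and w_supp: "\<forall>x. w x \<noteq> 0 \<longrightarrow> b \<le> g x \<and> g x \<le> c"
    using supp by (auto simp: v_def w_def)
  have "AE y in M. R v y \<noteq> 0 \<longrightarrow> a \<le> g y \<and> g y \<le> b" "AE y in M. R w y \<noteq> 0 \<longrightarrow> b \<le> g y \<and> g y \<le> c"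
    using v_supp w_supp assms(3,4) by (intro R_support v w; blast)+
  with R_level[OF v, of b] have disjoint: "AE y in M. R v y = 0 \<or> R w y = 0"
    by eventually_elim force
  have "sq_norm M (R u) = sq_norm M (\<lambda>y. R v y + R w y)"
    using R_add[OF v w] unfolding split[symmetric] by (intro sq_norm_cong_AE) auto
  then have "(sq_norm M (R u))\<^sup>2 = (sq_norm M (R v))\<^sup>2 + (sq_norm M (R w))\<^sup>2"
    using sq_norm_disjoint_supports[OF Rv Rw disjoint] by simp
  also have "\<dots> \<le> (e * sq_norm M v)\<^sup>2 + (e * sq_norm M w)\<^sup>2"
    using assms(1,2) v w v_supp w_supp by (intro add_mono power_mono) (auto simp: bound_on_def)
  also have "\<dots> = e\<^sup>2 * ((sq_norm M v)\<^sup>2 + (sq_norm M w)\<^sup>2)"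
    by (simp add: power_mult_distrib algebra_simps)
  also have "(sq_norm M v)\<^sup>2 + (sq_norm M w)\<^sup>2 = (sq_norm M u)\<^sup>2"
    unfolding split by (rule sq_norm_disjoint_supports[OF v w, symmetric]) (auto simp: v_def w_def)
  finally show "sq_norm M (R u) \<le> e * sq_norm M u"
    using assms(5) by (intro power2_le_imp_le[of "sq_norm M (R u)"]) (simp_all add: power_mult_distrib)
qed

text \<open>If the claim fails at \<^term>\<open>t\<close>, there are \<open>v\<^sub>m\<close> in the unit ball with images of norm at least \<^term>\<open>e\<close>
  that are supported where \<open>|g - t| \<le> 1 / (m + 1)\<close>. A limit point of these images is zero outside
  \<open>{g = t}\<close>, since it is eventually approximated by functions that vanish beyond any given distance from
  \<^term>\<open>t\<close>; it is zero on \<open>{g = t}\<close> because the images are. This contradicts the lower bound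
  \<^term>\<open>e\<close>.\<close>

lemma bound_on_small:
  assumes "0 < e"
  shows "\<exists>d>0. \<forall>a b. a \<le> t \<and> t \<le> b \<and> b - a < d \<longrightarrow> bound_on e a b"
proof (rule ccontr)
  assume "\<not> ?thesis"
  then have bad: "\<exists>a b. a \<le> t \<and> t \<le> b \<and> b - a < d \<and> \<not> bound_on e a b" if "0 < d" for d
    using that by blast
  define good where "good m v \<longleftrightarrow> v \<in> sq_integrable M \<and> sq_norm M v \<le> 1 \<and> e \<le> sq_norm M (R v) \<and>
      (AE y in M. R v y \<noteq> 0 \<longrightarrow> \<bar>g y - t\<bar> \<le> 1 / real (Suc m))" for m v
  have "\<exists>v. good m v" for m
  proof -
    obtain a b u where ab: "a \<le> t" "t \<le> b" "b - a < 1 / real (Suc m)" and u: "u \<in> sq_integrable M"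
      and supp: "\<forall>x. u x \<noteq> 0 \<longrightarrow> a \<le> g x \<and> g x \<le> b" and large: "e * sq_norm M u < sq_norm M (R u)"
      using bad[of "1 / real (Suc m)"] by (auto simp: bound_on_def not_le)
    have "sq_norm M u \<noteq> 0"
      using R_bounded[OF u] large by auto
    then have pos: "0 < sq_norm M u"
      by (simp add: less_le)
    define c where "c = complex_of_real (1 / sq_norm M u)"
    have c: "cmod c = 1 / sq_norm M u"
      by (simp add: c_def norm_divide)
    let ?v = "\<lambda>x. c * u x"
    note v = sq_integrable_scale[OF u, of c]
    have "sq_norm M (R ?v) = sq_norm M (\<lambda>y. c * R u y)"
      using R_scale[OF u, of c]
      by (intro sq_norm_cong_AE) (auto intro!: sq_integrable_measurable sq_integrable_scale R_sq u)
    then have "sq_norm M (R ?v) = sq_norm M (R u) / sq_norm M u"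
      by (simp add: sq_norm_scale c)
    then have "e \<le> sq_norm M (R ?v)"
      using large pos by (simp add: pos_le_divide_eq)
    moreover have "sq_norm M ?v \<le> 1"
      using pos by (simp add: sq_norm_scale c)
    moreover have "AE y in M. R ?v y \<noteq> 0 \<longrightarrow> \<bar>g y - t\<bar> \<le> 1 / real (Suc m)"
    proof (rule R_support_ball[OF v])
      show "\<bar>g x - t\<bar> \<le> 1 / real (Suc m)" if "c * u x \<noteq> 0" for x
        using supp[rule_format, of x] ab that by auto
    qed simp
    ultimately have "good m ?v"
      using v by (simp add: good_def)
    then show ?thesis by blast
  qed
  then obtain s where "good m (s m)" for m
    by metis
  then have s: "\<And>m. s m \<in> sq_integrable M" "\<And>m. sq_norm M (s m) \<le> 1"
    "\<And>m. e \<le> sq_norm M (R (s m))"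
    and s_supp: "\<And>m. AE y in M. R (s m) y \<noteq> 0 \<longrightarrow> \<bar>g y - t\<bar> \<le> 1 / real (Suc m)"
    unfolding good_def by blast+
  obtain r b where r: "strict_mono (r :: nat \<Rightarrow> nat)" and b: "b \<in> sq_integrable M"
    and lim: "(\<lambda>m. sq_norm M (\<lambda>y. R (s (r m)) y - b y)) \<longlonglongrightarrow> 0"
    using R_compact[of s, OF s(1,2)] by (elim exE conjE) (rule that)
  note [measurable] = b[THEN sq_integrable_measurable]
  have zero: "AE y in M. (1 / real (Suc j) < \<bar>g y - t\<bar> \<or> g y = t) \<longrightarrow> b y = 0" for j
  proof -
    define F where "F = {y. 1 / real (Suc j) < \<bar>g y - t\<bar> \<or> g y = t}"
    let ?b = "\<lambda>y. indicator F y * b y"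
    have meas: "?b \<in> borel_measurable M"
      unfolding F_def by measurable
    have b_sq: "?b \<in> sq_integrable M"
      by (rule sq_integrable_dominated(1)[OF b meas, of 1]) (auto simp: indicator_def)
    have "sq_norm M ?b \<le> sq_norm M (\<lambda>y. R (s (r m)) y - b y)" if "j \<le> m" for m
    proof -
      have le: "1 / real (Suc (r m)) \<le> 1 / real (Suc j)"
        using seq_suble[OF r, of m] that by (intro divide_left_mono) auto
      have "AE y in M. cmod (?b y) \<le> 1 * cmod (R (s (r m)) y - b y)"
        using s_supp[of "r m"] R_level[OF s(1), of t "r m"]
      proof eventually_elim
        fix y assume y: "R (s (r m)) y \<noteq> 0 \<longrightarrow> \<bar>g y - t\<bar> \<le> 1 / real (Suc (r m))"
          "g y = t \<longrightarrow> R (s (r m)) y = 0"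
        show "cmod (?b y) \<le> 1 * cmod (R (s (r m)) y - b y)"
        proof (cases "y \<in> F")
          case True
          then have "R (s (r m)) y = 0"
            using y le unfolding F_def by (metis (mono_tags, lifting) mem_Collect_eq not_less order_trans)
          then show ?thesis using True by simp
        qed simp
      qed
      then show ?thesis
        using sq_integrable_dominated(2)[OF sq_integrable_diff[OF R_sq[OF s(1)] b] meas] by fastforce
    qed
    then have "sq_norm M ?b \<le> 0"
      by (intro LIMSEQ_le_const[OF lim]) blast
    then have "AE y in M. ?b y = 0"
      using AE_zero_of_sq_norm_zero[OF b_sq] sq_norm_nonneg[of M ?b] by linarith
    then show ?thesis
      by eventually_elim (auto simp: F_def indicator_def)
  qed
  have "AE y in M. \<forall>j. (1 / real (Suc j) < \<bar>g y - t\<bar> \<or> g y = t) \<longrightarrow> b y = 0"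
    using zero by (subst AE_all_countable) blast
  then have "AE y in M. b y = 0"
  proof eventually_elim
    fix y assume y: "\<forall>j. (1 / real (Suc j) < \<bar>g y - t\<bar> \<or> g y = t) \<longrightarrow> b y = 0"
    show "b y = 0"
    proof (cases "g y = t")
      case False
      then obtain j :: nat where "1 / real (Suc j) < \<bar>g y - t\<bar>"
        using nat_approx_posE[of "\<bar>g y - t\<bar>"] by auto
      then show ?thesis using y by blast
    qed (use y in blast)
  qed
  then have "sq_norm M (\<lambda>y. R (s (r m)) y - b y) = sq_norm M (R (s (r m)))" for m
    using R_sq[OF s(1), of "r m", THEN sq_integrable_measurable]
    by (intro sq_norm_cong_AE) auto
  then have "e \<le> 0"
    using s(3) by (intro LIMSEQ_le_const[OF lim]) auto
  then show False using assms by simp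
qed

lemma R_eq_zero:
  assumes u: "u \<in> sq_integrable M"
  shows "AE y in M. R u y = 0"
proof -
  have "- B \<le> B"
    using g_bounded[of undefined] by linarith
  have *: "sq_norm M (R u) \<le> e * sq_norm M u" if "0 < e" for e
  proof -
    have "bound_on e (- B) B"
      using \<open>- B \<le> B\<close>
    proof (rule Bolzano)
      show "bound_on e a c" if "bound_on e a b" "bound_on e b c" "a \<le> b" "b \<le> c" for a b c
        using bound_on_join[OF that] \<open>0 < e\<close> by simp
    qed (rule bound_on_small[OF \<open>0 < e\<close>])
    then show ?thesis
      using u g_bounded unfolding bound_on_def by (auto simp: abs_le_iff minus_le_iff)
  qed
  have "sq_norm M (R u) \<le> 0 + e" if "0 < e" for e
  proof -
    have pos: "0 < sq_norm M u + 1"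
      using sq_norm_nonneg[of M u] by linarith
    then have "sq_norm M (R u) \<le> e / (sq_norm M u + 1) * sq_norm M u"
      using \<open>0 < e\<close> by (intro *) simp
    also have "\<dots> \<le> e"
      using \<open>0 < e\<close> pos by (simp add: field_simps)
    finally show ?thesis by simp
  qed
  then have "sq_norm M (R u) \<le> 0"
    by (rule field_le_epsilon)
  then show ?thesis
    using AE_zero_of_sq_norm_zero[OF R_sq[OF u]] sq_norm_nonneg[of M "R u"] by linarith
qed

end

section \<open>Divided differences\<close>

text \<open>On the diagonal both sides are zero, so the identity holds everywhere.\<close>

lemma divided_difference_mult: "divided_difference f (x, y) * complex_of_real (x - y) = f x - f y"
  by (cases "x = y") (simp_all add: divided_difference_def)

text \<open>Let \<open>i\<close> be the indicator of \<^term>\<open>K\<close>, and \<open>g = i x\<close> and \<open>h = i f\<close> the truncations of the coordinate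
  and of \<^term>\<open>f\<close>. For every kernel \<open>k\<close> in the domain, with \<open>a = i u\<close>, \<open>b = g u\<close> and \<open>c = h u\<close>,
  the identity for \<open>\<phi>\<close> gives \<open>i I\<^bsub>\<phi>k\<^esub> b - g I\<^bsub>\<phi>k\<^esub> a = i I\<^sub>k c - h I\<^sub>k a\<close>, where \<open>\<phi>\<close> is the divided difference.
  When \<open>I\<^sub>k\<close> is close to \<^term>\<open>Z\<close>, hence to zero, and \<open>I\<^bsub>\<phi>k\<^esub>\<close> is close to \<^term>\<open>D\<close>, this bounds the norm of
  \<open>w = i D b - g D a\<close> by an arbitrarily small number.\<close>

lemma compression_commutes:
  fixes M :: "real measure" and f :: "real \<Rightarrow> complex"
  assumes "sigma_finite_measure M"
    and [measurable]: "(\<lambda>x. x) \<in> borel_measurable M" "f \<in> borel_measurable M" "K \<in> sets M"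
    and K: "\<forall>x\<in>K. \<bar>x\<bar> \<le> B" "\<forall>x\<in>K. cmod (f x) \<le> B" "0 \<le> B"
    and ZD: "(Z, D) \<in> norm_closure M (mult_graph M (divided_difference f))"
    and Z: "\<forall>u\<in>sq_integrable M. AE y in M. fun_op M Z u y = 0"
    and u: "u \<in> sq_integrable M"
  shows "AE y in M. indicator K y * fun_op M D (\<lambda>x. indicator K x * complex_of_real x * u x) y
    = indicator K y * complex_of_real y * fun_op M D (\<lambda>x. indicator K x * u x) y"
proof -
  interpret sigma_finite_measure M by fact
  let ?\<phi> = "divided_difference f"
  define i where "i x = (indicator K x :: complex)" for x
  define g where "g x = i x * complex_of_real x" for x
  define h where "h x = i x * f x" for x
  have [measurable]: "i \<in> borel_measurable M" "g \<in> borel_measurable M" "h \<in> borel_measurable M"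
    unfolding i_def g_def h_def by measurable
  have bnd: "cmod (i x) \<le> 1" "cmod (g x) \<le> B" "cmod (h x) \<le> B" for x
    using K by (auto simp: i_def g_def h_def indicator_def)
  define a where "a x = i x * u x" for x
  define b where "b x = g x * u x" for x
  define c where "c x = h x * u x" for x
  have a: "a \<in> sq_integrable M" "sq_norm M a \<le> sq_norm M u"
    unfolding a_def using sq_integrable_bounded_mult[OF u _ bnd(1)] sq_norm_bounded_mult[OF u _ bnd(1)]
    by simp_all
  have b: "b \<in> sq_integrable M" "sq_norm M b \<le> B * sq_norm M u"
    unfolding b_def using sq_integrable_bounded_mult[OF u _ bnd(2)] sq_norm_bounded_mult[OF u _ bnd(2)]
    by simp_all
  have c: "c \<in> sq_integrable M" "sq_norm M c \<le> B * sq_norm M u"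
    unfolding c_def using sq_integrable_bounded_mult[OF u _ bnd(3)] sq_norm_bounded_mult[OF u _ bnd(3)]
    by simp_all
  have comp: "Z \<in> compact_operators M" "D \<in> compact_operators M"
    using ZD by (auto simp: norm_closure_def)
  note D = comp(2)[THEN compact_operators_L2_linear, THEN L2_linear_PiE]
  have Da: "fun_op M D a \<in> sq_integrable M" and Db: "fun_op M D b \<in> sq_integrable M"
    using fun_op_sq_integrable[OF D] a b by auto
  note [measurable] = Da[THEN sq_integrable_measurable] Db[THEN sq_integrable_measurable]
  define w where "w y = i y * fun_op M D b y - g y * fun_op M D a y" for y
  have w: "w \<in> sq_integrable M"
    unfolding w_def using bnd
    by (intro sq_integrable_diff sq_integrable_bounded_mult[OF Db] sq_integrable_bounded_mult[OF Da]) auto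
  have small: "sq_norm M w \<le> e * (4 * B * sq_norm M u)" if e: "0 < e" for e
  proof -
    obtain k where "k \<in> mult_domain M ?\<phi>" and Zk: "near_kernel M e Z k"
      and Dk: "near_kernel M e D (\<lambda>z. ?\<phi> z * k z)"
      using ZD e unfolding norm_closure_mult_graph_iff by blast
    then have k: "k \<in> sq_integrable (M \<Otimes>\<^sub>M M)" "(\<lambda>z. ?\<phi> z * k z) \<in> sq_integrable (M \<Otimes>\<^sub>M M)"
      by (auto simp: mult_domain_def)
    let ?k = "kernel_op M k" and ?l = "kernel_op M (\<lambda>z. ?\<phi> z * k z)"
    note ksq = kernel_op_sq_integrable[OF k(1)] and lsq = kernel_op_sq_integrable[OF k(2)]
    have kernel: "AE y in M. i y * ?l b y - g y * ?l a y = i y * ?k c y - h y * ?k a y"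
      using AE_integrable_kernel[OF k(2) b(1)] AE_integrable_kernel[OF k(2) a(1)]
        AE_integrable_kernel[OF k(1) c(1)] AE_integrable_kernel[OF k(1) a(1)]
    proof eventually_elim
      fix y
      assume int: "integrable M (\<lambda>x. ?\<phi> (x, y) * k (x, y) * b x)"
        "integrable M (\<lambda>x. ?\<phi> (x, y) * k (x, y) * a x)"
        "integrable M (\<lambda>x. k (x, y) * c x)" "integrable M (\<lambda>x. k (x, y) * a x)"
      have "?l b y - complex_of_real y * ?l a y
          = (\<integral>x. ?\<phi> (x, y) * k (x, y) * b x - complex_of_real y * (?\<phi> (x, y) * k (x, y) * a x) \<partial>M)"
        using int(1,2) by (simp add: kernel_op_def)
      also have "\<dots> = (\<integral>x. k (x, y) * c x - f y * (k (x, y) * a x) \<partial>M)"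
      proof (rule Bochner_Integration.integral_cong[OF refl])
        fix x
        have "?\<phi> (x, y) * k (x, y) * b x - complex_of_real y * (?\<phi> (x, y) * k (x, y) * a x)
            = (?\<phi> (x, y) * complex_of_real (x - y)) * (k (x, y) * a x)"
          by (simp add: b_def a_def g_def algebra_simps)
        also have "\<dots> = k (x, y) * c x - f y * (k (x, y) * a x)"
          unfolding divided_difference_mult by (simp add: c_def a_def h_def algebra_simps)
        finally show "?\<phi> (x, y) * k (x, y) * b x - complex_of_real y * (?\<phi> (x, y) * k (x, y) * a x)
            = k (x, y) * c x - f y * (k (x, y) * a x)" .
      qed
      also have "\<dots> = ?k c y - f y * ?k a y"
        using int(3,4) by (simp add: kernel_op_def)
      finally show "i y * ?l b y - g y * ?l a y = i y * ?k c y - h y * ?k a y"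
        by (simp add: g_def h_def mult.assoc right_diff_distrib[symmetric])
    qed
    let ?p = "\<lambda>y. i y * (fun_op M D b y - ?l b y)" and ?q = "\<lambda>y. g y * (fun_op M D a y - ?l a y)"
    let ?r = "\<lambda>y. i y * ?k c y" and ?s = "\<lambda>y. h y * ?k a y"
    have sq: "?p \<in> sq_integrable M" "?q \<in> sq_integrable M" "?r \<in> sq_integrable M" "?s \<in> sq_integrable M"
      using bnd a b c Da Db
      by (auto intro!: sq_integrable_bounded_mult sq_integrable_diff ksq lsq)
    have Zk': "sq_norm M (?k v) \<le> e * sq_norm M v" if v: "v \<in> sq_integrable M" for v
    proof -
      note Zv = fun_op_sq_integrable[OF comp(1)[THEN compact_operators_L2_linear, THEN L2_linear_PiE] v]
      have "sq_norm M (?k v) \<le> 1 * sq_norm M (\<lambda>y. fun_op M Z v y - ?k v y)"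
        using Z[rule_format, OF v]
        by (intro sq_integrable_dominated(2) sq_integrable_diff Zv ksq[OF v] sq_integrable_measurable[OF ksq[OF v]])
          (auto elim: eventually_mono)
      also have "\<dots> \<le> 1 * (e * sq_norm M v)"
        using Zk v unfolding near_kernel_def by (intro mult_left_mono) auto
      finally show ?thesis by simp
    qed
    have p: "sq_norm M ?p \<le> 1 * (e * (B * sq_norm M u))"
    proof (rule order_trans[OF sq_norm_bounded_mult[OF sq_integrable_diff[OF Db lsq[OF b(1)]] _ bnd(1)]])
      show "1 * sq_norm M (\<lambda>y. fun_op M D b y - ?l b y) \<le> 1 * (e * (B * sq_norm M u))"
        using Dk b e unfolding near_kernel_def
        by (metis (no_types, lifting) less_imp_le mult_1 mult_left_mono order_trans)
    qed measurable
    have q: "sq_norm M ?q \<le> B * (e * sq_norm M u)"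
    proof (rule order_trans[OF sq_norm_bounded_mult[OF sq_integrable_diff[OF Da lsq[OF a(1)]] _ bnd(2)]])
      show "B * sq_norm M (\<lambda>y. fun_op M D a y - ?l a y) \<le> B * (e * sq_norm M u)"
        using Dk a e K(3) unfolding near_kernel_def
        by (metis (no_types, lifting) less_imp_le mult_left_mono order_trans)
    qed measurable
    have r: "sq_norm M ?r \<le> 1 * (e * (B * sq_norm M u))"
    proof (rule order_trans[OF sq_norm_bounded_mult[OF ksq[OF c(1)] _ bnd(1)]])
      show "1 * sq_norm M (?k c) \<le> 1 * (e * (B * sq_norm M u))"
        using Zk'[OF c(1)] c(2) e
        by (metis (no_types, lifting) less_imp_le mult_1 mult_left_mono order_trans)
    qed measurable
    have s: "sq_norm M ?s \<le> B * (e * sq_norm M u)"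
    proof (rule order_trans[OF sq_norm_bounded_mult[OF ksq[OF a(1)] _ bnd(3)]])
      show "B * sq_norm M (?k a) \<le> B * (e * sq_norm M u)"
        using Zk'[OF a(1)] a(2) e K(3)
        by (metis (no_types, lifting) less_imp_le mult_left_mono order_trans)
    qed measurable
    \<comment> \<open>Each of the four terms is a bounded multiple of an approximation error; by \<open>kernel\<close> the
      contributions of the kernels cancel.\<close>
    have "sq_norm M w = sq_norm M (\<lambda>y. (?p y - ?q y) + (?r y - ?s y))"
    proof (rule sq_norm_cong_AE)
      show "AE y in M. w y = (?p y - ?q y) + (?r y - ?s y)"
        using kernel by eventually_elim (simp add: w_def algebra_simps)
    qed (use w sq_integrable_add[OF sq_integrable_diff[OF sq(1,2)] sq_integrable_diff[OF sq(3,4)]]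
      in \<open>simp_all add: sq_integrable_measurable\<close>)
    also have "\<dots> \<le> (sq_norm M ?p + sq_norm M ?q) + (sq_norm M ?r + sq_norm M ?s)"
      using sq_norm_triangle[OF sq_integrable_diff[OF sq(1,2)] sq_integrable_diff[OF sq(3,4)]]
        sq_norm_triangle_diff[OF sq(1,2)] sq_norm_triangle_diff[OF sq(3,4)] by linarith
    also have "\<dots> \<le> e * (4 * B * sq_norm M u)"
      using p q r s by (simp add: algebra_simps)
    finally show ?thesis .
  qed
  have "sq_norm M w \<le> 0"
  proof (rule field_le_epsilon)
    fix d :: real assume "0 < d"
    have pos: "0 < 4 * B * sq_norm M u + 1"
      using K(3) by (simp add: add_nonneg_pos)
    then have "sq_norm M w \<le> d / (4 * B * sq_norm M u + 1) * (4 * B * sq_norm M u)"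
      using \<open>0 < d\<close> by (intro small) simp
    also have "\<dots> \<le> d"
      using \<open>0 < d\<close> pos by (simp add: field_simps)
    finally show "sq_norm M w \<le> 0 + d" by simp
  qed
  then have "AE y in M. w y = 0"
    using AE_zero_of_sq_norm_zero[OF w] sq_norm_nonneg[of M w] by linarith
  then show ?thesis
    by eventually_elim (simp add: w_def a_def[abs_def] b_def[abs_def] g_def i_def)
qed

text \<open>The compression of \<^term>\<open>D\<close> to \<^term>\<open>K\<close> is a compact operator that commutes with multiplication by
  the coordinate cut off outside \<^term>\<open>K\<close>. Level sets of the cut-off coordinate are points inside
  \<^term>\<open>K\<close>, apart from the complement of \<^term>\<open>K\<close>, where the compression has no values.\<close>

lemma compression_zero:
  fixes M :: "real measure" and f :: "real \<Rightarrow> complex"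
  assumes sf: "sigma_finite_measure M"
    and meas [measurable]: "(\<lambda>x. x) \<in> borel_measurable M" "f \<in> borel_measurable M" "K \<in> sets M"
    and diffuse: "\<And>t. AE x in M. x \<noteq> t"
    and K: "\<forall>x\<in>K. \<bar>x\<bar> \<le> B" "\<forall>x\<in>K. cmod (f x) \<le> B" "0 \<le> B"
    and ZD: "(Z, D) \<in> norm_closure M (mult_graph M (divided_difference f))"
    and Z: "\<forall>u\<in>sq_integrable M. AE y in M. fun_op M Z u y = 0"
    and u: "u \<in> sq_integrable M"
  shows "AE y in M. indicator K y * fun_op M D (\<lambda>x. indicator K x * u x) y = 0"
proof -
  let ?i = "indicator K :: real \<Rightarrow> complex"
  define R where "R u y = ?i y * fun_op M D (\<lambda>x. ?i x * u x) y" for u y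
  have comp: "D \<in> compact_operators M"
    using ZD by (auto simp: norm_closure_def)
  note lin = comp[THEN compact_operators_L2_linear]
  note D = lin[THEN L2_linear_PiE]
  have restrict: "(\<lambda>x. ?i x * v x) \<in> sq_integrable M" "sq_norm M (\<lambda>x. ?i x * v x) \<le> sq_norm M v"
    if "v \<in> sq_integrable M" for v
    using sq_integrable_bounded_mult[OF that, of ?i 1] sq_norm_bounded_mult[OF that, of ?i 1]
    by (auto simp: indicator_def)
  have R_sq: "R v \<in> sq_integrable M" if "v \<in> sq_integrable M" for v
    unfolding R_def using restrict fun_op_sq_integrable[OF D] that by simp
  obtain C where C: "0 \<le> C" "\<And>u. u \<in> sq_integrable M \<Longrightarrow> sq_norm M (fun_op M D u) \<le> C * sq_norm M u"
    using compact_operators_bounded[OF comp] by blast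
  interpret compact_commuting_op M R "\<lambda>x. indicator K x * x" B C
  proof
    fix v assume v: "v \<in> sq_integrable M"
    show "R v \<in> sq_integrable M" by (rule R_sq[OF v])
    show "AE y in M. R (\<lambda>x. c * v x) y = c * R v y" for c
      using fun_op_scale[OF lin restrict(1)[OF v], of c]
      by eventually_elim (simp add: R_def mult.left_commute)
    have "sq_norm M (R v) \<le> sq_norm M (fun_op M D (\<lambda>x. ?i x * v x))"
      unfolding R_def using restrict(2)[OF fun_op_sq_integrable[OF D restrict(1)[OF v]]] .
    also have "\<dots> \<le> C * sq_norm M (\<lambda>x. ?i x * v x)"
      by (rule C(2)[OF restrict(1)[OF v]])
    also have "\<dots> \<le> C * sq_norm M v"
      by (intro mult_left_mono restrict(2)[OF v] C(1))
    finally show "sq_norm M (R v) \<le> C * sq_norm M v" .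
    show "AE y in M. R (\<lambda>x. complex_of_real (indicator K x * x) * v x) y
        = complex_of_real (indicator K y * y) * R v y"
      using compression_commutes[OF sf meas K ZD Z v]
    proof eventually_elim
      fix y
      assume y: "?i y * fun_op M D (\<lambda>x. ?i x * complex_of_real x * v x) y
        = ?i y * complex_of_real y * fun_op M D (\<lambda>x. ?i x * v x) y"
      have "(\<lambda>x. ?i x * (complex_of_real (indicator K x * x) * v x)) = (\<lambda>x. ?i x * complex_of_real x * v x)"
        by (auto simp: indicator_def)
      then show "R (\<lambda>x. complex_of_real (indicator K x * x) * v x) y
          = complex_of_real (indicator K y * y) * R v y"
        using y by (auto simp: R_def indicator_def split: if_splits)
    qed
    show "AE y in M. indicator K y * y = t \<longrightarrow> R v y = 0" for t
      using diffuse[of t] by eventually_elim (auto simp: R_def indicator_def)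
    fix w assume w: "w \<in> sq_integrable M"
    show "AE y in M. R (\<lambda>x. v x + w x) y = R v y + R w y"
      using fun_op_add[OF lin restrict(1)[OF v] restrict(1)[OF w]]
      by eventually_elim (simp add: R_def distrib_left)
  next
    fix s :: "nat \<Rightarrow> real \<Rightarrow> complex"
    assume s: "\<And>m. s m \<in> sq_integrable M" "\<And>m. sq_norm M (s m) \<le> 1"
    have bound: "sq_norm M (\<lambda>x. ?i x * s m x) \<le> 1" for m
      using restrict(2)[OF s(1)] s(2) order_trans by blast
    obtain r v where r: "strict_mono (r :: nat \<Rightarrow> nat)" and v: "v \<in> sq_integrable M"
      and lim: "(\<lambda>m. sq_norm M (\<lambda>y. fun_op M D (\<lambda>x. ?i x * s (r m) x) y - v y)) \<longlonglongrightarrow> 0"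
      by (rule compact_operators_subseq[OF comp restrict(1)[OF s(1)] bound])
    have "sq_norm M (\<lambda>y. R (s (r m)) y - ?i y * v y)
        \<le> sq_norm M (\<lambda>y. fun_op M D (\<lambda>x. ?i x * s (r m) x) y - v y)" for m
      using restrict(2)[OF sq_integrable_diff[OF fun_op_sq_integrable[OF D restrict(1)[OF s(1)]] v]]
      by (simp add: R_def right_diff_distrib)
    then have "(\<lambda>m. sq_norm M (\<lambda>y. R (s (r m)) y - ?i y * v y)) \<longlonglongrightarrow> 0"
      by (intro Lim_null_comparison[OF _ lim]) simp
    then show "\<exists>r v. strict_mono (r :: nat \<Rightarrow> nat) \<and> v \<in> sq_integrable M \<and>
        (\<lambda>m. sq_norm M (\<lambda>y. R (s (r m)) y - v y)) \<longlonglongrightarrow> 0"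
      using r restrict(1)[OF v] by blast
  next
    show "\<bar>indicator K x * x\<bar> \<le> B" for x
      using K by (auto simp: indicator_def)
  qed (use C(1) in measurable)
  show ?thesis
    using R_eq_zero[OF u] by (simp add: R_def)
qed

text \<open>The sets \<open>K n\<close> where \<open>|x|\<close> and \<open>|f x|\<close> are at most \<open>n\<close> exhaust the space. If \<^term>\<open>u\<close> is cut off to
  \<open>K m\<close>, the vanishing of the compressions to all larger \<open>K n\<close> shows that \<^term>\<open>D\<close> annihilates it;
  the cut-offs converge to \<^term>\<open>u\<close>, and \<^term>\<open>D\<close> is bounded.\<close>

lemma closure_limit_zero:
  fixes M :: "real measure" and f :: "real \<Rightarrow> complex"
  assumes sf: "sigma_finite_measure M"
    and meas [measurable]: "(\<lambda>x. x) \<in> borel_measurable M" "f \<in> borel_measurable M"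
    and diffuse: "\<And>t. AE x in M. x \<noteq> t"
    and ZD: "(Z, D) \<in> norm_closure M (mult_graph M (divided_difference f))"
    and Z: "\<forall>u\<in>sq_integrable M. AE y in M. fun_op M Z u y = 0"
    and u: "u \<in> sq_integrable M"
  shows "AE y in M. fun_op M D u y = 0"
proof -
  have comp: "D \<in> compact_operators M"
    using ZD by (auto simp: norm_closure_def)
  note lin = comp[THEN compact_operators_L2_linear]
  note D = lin[THEN L2_linear_PiE]
  note [measurable] = u[THEN sq_integrable_measurable]
  define K where "K n = {x \<in> space M. \<bar>x\<bar> \<le> real n \<and> cmod (f x) \<le> real n}" for n :: nat
  have K_sets [measurable]: "K n \<in> sets M" for n
    unfolding K_def by measurable
  have K_mono: "K m \<subseteq> K n" if "m \<le> n" for m n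
    using that by (fastforce simp: K_def)
  have K_cover: "\<exists>m. \<forall>n\<ge>m. x \<in> K n" if x: "x \<in> space M" for x
  proof -
    obtain m :: nat where "max \<bar>x\<bar> (cmod (f x)) \<le> real m"
      using real_arch_simple by blast
    then have "x \<in> K m" using x by (simp add: K_def)
    then show ?thesis using K_mono by blast
  qed
  define cut where "cut m x = indicator (K m) x * u x" for m x
  have cut: "cut m \<in> sq_integrable M" for m
    unfolding cut_def by (rule sq_integrable_bounded_mult[OF u, of _ 1]) (auto simp: indicator_def)
  have cut_zero: "AE y in M. fun_op M D (cut m) y = 0" for m
  proof -
    have "AE y in M. indicator (K n) y * fun_op M D (cut m) y = 0" if "m \<le> n" for n
    proof -
      have eq: "(\<lambda>x. indicator (K n) x * cut m x) = cut m"
        using K_mono[OF that] by (intro ext) (auto simp: cut_def indicator_def)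
      have "\<forall>x\<in>K n. \<bar>x\<bar> \<le> real n" "\<forall>x\<in>K n. cmod (f x) \<le> real n"
        by (auto simp: K_def)
      from compression_zero[OF sf meas K_sets[of n] diffuse this of_nat_0_le_iff ZD Z cut[of m]]
      show ?thesis unfolding eq .
    qed
    then have "AE y in M. \<forall>n. m \<le> n \<longrightarrow> indicator (K n) y * fun_op M D (cut m) y = 0"
      by (subst AE_all_countable) simp
    then show ?thesis
      using AE_space
    proof eventually_elim
      fix y assume y: "\<forall>n. m \<le> n \<longrightarrow> indicator (K n) y * fun_op M D (cut m) y = 0" "y \<in> space M"
      obtain l where "\<forall>n\<ge>l. y \<in> K n"
        using K_cover[OF y(2)] by blast
      then show "fun_op M D (cut m) y = 0"
        using y(1)[rule_format, of "max l m"] by simp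
    qed
  qed
  obtain C where C: "0 \<le> C" "\<And>u. u \<in> sq_integrable M \<Longrightarrow> sq_norm M (fun_op M D u) \<le> C * sq_norm M u"
    using compact_operators_bounded[OF comp] by blast
  have rest: "(\<lambda>x. u x - cut m x) \<in> sq_integrable M" for m
    by (rule sq_integrable_diff[OF u cut])
  have "(\<lambda>m. \<integral>x. (cmod (u x - cut m x))\<^sup>2 \<partial>M) \<longlonglongrightarrow> (\<integral>x. 0 \<partial>M)"
  proof (rule integral_dominated_convergence[where w = "\<lambda>x. (cmod (u x))\<^sup>2"])
    show "integrable M (\<lambda>x. (cmod (u x))\<^sup>2)" by (rule sq_integrableD(2)[OF u])
    show "AE x in M. (\<lambda>m. (cmod (u x - cut m x))\<^sup>2) \<longlonglongrightarrow> 0"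
    proof (rule AE_I2)
      fix x assume "x \<in> space M"
      then have "eventually (\<lambda>m. (cmod (u x - cut m x))\<^sup>2 = 0) sequentially"
        using K_cover unfolding eventually_sequentially by (fastforce simp: cut_def)
      then show "(\<lambda>m. (cmod (u x - cut m x))\<^sup>2) \<longlonglongrightarrow> 0"
        by (rule tendsto_eventually)
    qed
    show "AE x in M. norm ((cmod (u x - cut m x))\<^sup>2) \<le> (cmod (u x))\<^sup>2" for m
      by (rule AE_I2) (simp add: cut_def indicator_def)
    show "(\<lambda>x. (cmod (u x - cut m x))\<^sup>2) \<in> borel_measurable M" for m
      unfolding cut_def by measurable
  qed simp
  then have "(\<lambda>m. sqrt (\<integral>x. (cmod (u x - cut m x))\<^sup>2 \<partial>M)) \<longlonglongrightarrow> sqrt 0"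
    by (intro tendsto_real_sqrt) simp
  then have lim: "(\<lambda>m. C * sq_norm M (\<lambda>x. u x - cut m x)) \<longlonglongrightarrow> C * 0"
    by (intro tendsto_mult tendsto_const) (simp add: sq_norm_def)
  have "sq_norm M (fun_op M D u) \<le> C * sq_norm M (\<lambda>x. u x - cut m x)" for m
  proof -
    have "AE y in M. fun_op M D u y = fun_op M D (\<lambda>x. u x - cut m x) y"
      using fun_op_add[OF lin rest[of m] cut[of m]] cut_zero[of m] by eventually_elim simp
    then have "sq_norm M (fun_op M D u) = sq_norm M (fun_op M D (\<lambda>x. u x - cut m x))"
      by (intro sq_norm_cong_AE sq_integrable_measurable fun_op_sq_integrable[OF D] u rest)
    then show ?thesis using C(2)[OF rest] by simp
  qed
  then have "sq_norm M (fun_op M D u) \<le> C * 0"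
    by (intro LIMSEQ_le_const[OF lim]) blast
  then show ?thesis
    using AE_zero_of_sq_norm_zero[OF fun_op_sq_integrable[OF D u]] sq_norm_nonneg[of M "fun_op M D u"]
    by simp
qed

text \<open>Two values \<open>T\<close>, \<open>T'\<close> of the closed graph at \<open>S\<close> give the point \<open>(S - S, T - T')\<close> of the closed graph,
  to which \<open>closure_limit_zero\<close> applies.\<close>

lemma closable_multiplier_divided_difference:
  fixes M :: "real measure" and f :: "real \<Rightarrow> complex"
  assumes sf: "sigma_finite_measure M"
    and meas [measurable]: "(\<lambda>x. x) \<in> borel_measurable M" "f \<in> borel_measurable M"
    and diffuse: "\<And>t. AE x in M. x \<noteq> t"
  shows "closable_multiplier M (divided_difference f)"
proof -
  interpret sigma_finite_measure M by fact
  let ?G = "norm_closure M (mult_graph M (divided_difference f))"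
  have "T = T'" if ST: "(S, T) \<in> ?G" "(S, T') \<in> ?G" for S T T'
  proof -
    have comp: "S \<in> compact_operators M" "T \<in> compact_operators M" "T' \<in> compact_operators M"
      using ST by (auto simp: norm_closure_def)
    note PiE = comp[THEN compact_operators_L2_linear, THEN L2_linear_PiE]
    define Z where "Z = op_add M S (op_scale M (-1) S)"
    define D where "D = op_add M T (op_scale M (-1) T')"
    have ZD: "(Z, D) \<in> ?G"
      unfolding Z_def D_def
      by (intro norm_closure_mult_graph_add norm_closure_mult_graph_scale ST)
    have diff: "AE y in M. fun_op M (op_add M A (op_scale M (-1) A')) u y = fun_op M A u y - fun_op M A' u y"
      if "A \<in> L2 M \<rightarrow>\<^sub>E L2 M" "A' \<in> L2 M \<rightarrow>\<^sub>E L2 M" "u \<in> sq_integrable M" for A A' u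
      using fun_op_op_add[OF that(1) op_scale_PiE[OF that(2)] that(3), of "-1"]
        fun_op_op_scale[OF that(2,3), of "-1"]
      by eventually_elim simp
    have Z: "\<forall>u\<in>sq_integrable M. AE y in M. fun_op M Z u y = 0"
      using diff[OF PiE(1,1)] by (simp add: Z_def)
    show "T = T'"
    proof (rule L2_op_eqI[OF PiE(2,3)])
      fix u assume u: "u \<in> sq_integrable M"
      show "AE y in M. fun_op M T u y = fun_op M T' u y"
        using closure_limit_zero[OF sf meas diffuse ZD Z u] diff[OF PiE(2,3) u]
        unfolding D_def by eventually_elim simp
    qed
  qed
  then have "single_valued ?G"
    by (auto simp: single_valued_def)
  moreover have "?G \<subseteq> compact_operators M \<times> compact_operators M"
    by (auto simp: norm_closure_def)
  ultimately have "is_operator_graph M ?G"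
    unfolding is_operator_graph_def
    using norm_closure_mult_graph_nonempty norm_closure_mult_graph_add norm_closure_mult_graph_scale
    by (auto simp: split_beta)
  moreover have "divided_difference f \<in> borel_measurable (M \<Otimes>\<^sub>M M)"
    unfolding divided_difference_def by measurable
  ultimately show ?thesis
    by (simp add: closable_multiplier_def)
qed

section \<open>Non-atomic regular Borel measures\<close>

lemma non_atomic_emeasure_singleton:
  assumes "non_atomic M" "{t} \<in> sets M"
  shows "emeasure M {t} = 0"
proof (rule ccontr)
  assume "emeasure M {t} \<noteq> 0"
  then have "atom M {t}"
    using assms(2) by (auto simp: atom_def zero_less_iff_neq_zero subset_singleton_iff)
  then show False
    using assms(1) by (auto simp: non_atomic_def)
qed

lemma regular_borel_measure_sigma_finite:
  assumes "regular_borel_measure \<mu>"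
  shows "sigma_finite_measure \<mu>"
proof
  let ?A = "range (\<lambda>n::nat. {- real n..real n})"
  have sp: "space \<mu> = UNIV"
    using assms sets_eq_imp_space_eq[of \<mu> borel] by (simp add: regular_borel_measure_def)
  have "\<Union>?A = UNIV"
  proof (rule set_eqI)
    fix x :: real
    obtain n :: nat where "\<bar>x\<bar> \<le> real n"
      using real_arch_simple by blast
    then show "x \<in> \<Union>?A \<longleftrightarrow> x \<in> UNIV"
      by (auto simp: abs_le_iff minus_le_iff)
  qed
  moreover have "emeasure \<mu> {- real n..real n} \<noteq> \<infinity>" for n
    using assms unfolding regular_borel_measure_def
    by (metis compact_Icc infinity_ennreal_def less_irrefl)
  moreover have "{- real n..real n} \<in> sets \<mu>" for n
    using assms by (simp add: regular_borel_measure_def)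
  ultimately have "countable ?A \<and> ?A \<subseteq> sets \<mu> \<and> \<Union>?A = space \<mu> \<and> (\<forall>a\<in>?A. emeasure \<mu> a \<noteq> \<infinity>)"
    unfolding sp by blast
  then show "\<exists>A. countable A \<and> A \<subseteq> sets \<mu> \<and> \<Union>A = space \<mu> \<and> (\<forall>a\<in>A. emeasure \<mu> a \<noteq> \<infinity>)"
    by (rule exI)
qed

theorem corollary6p5:
  fixes J :: "real set" and \<mu> :: "real measure" and f :: "real \<Rightarrow> complex"
  assumes "open J" and "is_interval J"
    and "regular_borel_measure \<mu>" and "non_atomic \<mu>" and "J \<subseteq> measure_support \<mu>"
    and "continuous_on J f"
  shows "closable_multiplier (restrict_space \<mu> J) (divided_difference f)"
proof (rule closable_multiplier_divided_difference)
  have sets: "sets \<mu> = sets borel"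
    using assms(3) by (simp add: regular_borel_measure_def)
  have J: "J \<in> sets \<mu>" "J \<inter> space \<mu> \<in> sets \<mu>"
    using assms(1) sets sets_eq_imp_space_eq[OF sets] by auto
  show "sigma_finite_measure (restrict_space \<mu> J)"
    by (rule sigma_finite_measure_restrict_space[OF regular_borel_measure_sigma_finite[OF assms(3)] J(1)])
  show "(\<lambda>x. x) \<in> borel_measurable (restrict_space \<mu> J)"
    using sets by (intro measurable_restrict_space1) simp
  have "f \<in> borel_measurable (restrict_space borel J)"
    by (rule borel_measurable_continuous_on_restrict[OF assms(6)])
  then show "f \<in> borel_measurable (restrict_space \<mu> J)"
    using measurable_cong_sets[OF sets_restrict_space_cong[OF sets, of J] refl] by blast
  show "AE x in restrict_space \<mu> J. x \<noteq> t" for t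
  proof -
    have "{t} \<in> null_sets \<mu>"
      using non_atomic_emeasure_singleton[OF assms(4)] sets by (auto simp: null_sets_def)
    then have "AE x in \<mu>. x \<noteq> t"
      by (auto dest: AE_not_in)
    then show ?thesis
      by (subst AE_restrict_space_iff[OF J(2)]) (auto elim: eventually_mono)
  qed
qed

end
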